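(* For $i=1,2,3$ and $\mu$-almost every $x\in[0,1)$, the limit $f_i=\lim_{n\to\infty}\frac1n\#\{1\le k\le n: a_k(x)=i\}$ exists, is independent of $x$, and satisfies $|f_i - F_i|<10^{-50}$ where $F_1=0.46407962944716719166021454266242962642460872990983$, $F_2=0.30441904494046044774395954980142705829742520632111$, $F_3=0.23150132561237236059582590753614331527796606376905$.
   Context: Let $T\colon[0,1)\to[0,1)$ be the Bolyai–Rényi map: $T(x)=x^2+2x-(i-1)$ for $x\in I_i$, where $I_1=[0,\sqrt2-1)$, $I_2=[\sqrt2-1,\sqrt3-1)$, $I_3=[\sqrt3-1,1)$. Let $\mu$ be its unique absolutely continuous invariant probability measure. The radical digits of $x$ are $a_n(x)=i$ iff $T^{n-1}(x)\in I_i$, so that $x=-1+\sqrt{a_1+\sqrt{a_2+\cdots}}$. *)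

theory Defs
  imports "HOL-Probability.Probability"
begin

text \<open>Index of the interval I_i containing x (intended for x in [0,1)).\<close>
definition BR_index :: "real \<Rightarrow> nat" where
  "BR_index x = (if x < sqrt 2 - 1 then 1 else if x < sqrt 3 - 1 then 2 else 3)"

definition BR_map :: "real \<Rightarrow> real" where
  "BR_map x = x ^ 2 + 2 * x - (real (BR_index x) - 1)"

text \<open>Radical digits: a_n(x) = i iff T^(n-1)(x) in I_i  (n >= 1).\<close>
definition BR_digit :: "nat \<Rightarrow> real \<Rightarrow> nat" where
  "BR_digit n x = BR_index ((BR_map ^^ (n - 1)) x)"

definition BR_acim :: "real measure \<Rightarrow> bool" where
  "BR_acim M \<longleftrightarrow> prob_space M
     \<and> sets M = sets (restrict_space lborel {0..<1})
     \<and> absolutely_continuous (restrict_space lborel {0..<1}) M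
     \<and> BR_map \<in> measurable M M
     \<and> distr M M BR_map = M"

definition BR_F :: "nat \<Rightarrow> real" where
  "BR_F i = (if i = 1 then 0.46407962944716719166021454266242962642460872990983
             else if i = 2 then 0.30441904494046044774395954980142705829742520632111
             else 0.23150132561237236059582590753614331527796606376905)"

end

theory Submission
  imports Defs "HOL-Library.Discrete_Functions"
begin

text \<open>The transfer operator \<open>L u x = (\<Sum>i. u (sqrt (x + i) - 1) / (2 * sqrt (x + i)))\<close> multiplies the
  Lipschitz constant of mean-zero functions by at most \<open>17/20\<close>. With respect to Lebesgue measure the
  correlations of the digit indicators therefore decay exponentially, so second moments along the
  squares give the almost everywhere frequency \<open>f\<^sub>i = lim (\<integral> over I\<^sub>i of L ^ n 1)\<close>; a measure that is
  absolutely continuous inherits it. The same contraction turns any explicit \<open>p\<close> for which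
  \<open>p - L p\<close> has a tiny Lipschitz constant into an equally good approximation of \<open>f\<^sub>i\<close>. We take
  \<open>p\<close> to be a sum of three integer polynomials \<open>P\<^sub>i\<close>, with \<open>P\<^sub>i\<close> close to the \<open>i\<close>-th summand of
  \<open>L p\<close>, so that \<open>f\<^sub>i\<close> is nearly \<open>\<integral> P\<^sub>i / \<integral> p\<close>; closeness is checked by substituting a polynomial
  parametrisation of \<open>sqrt (x + i)\<close> and bounding the coefficients of the resulting polynomial.\<close>



text \<open>The contraction holds on mean-zero functions because there the sup norm is at most the
  Lipschitz constant: \<open>L\<close> costs sum 1/(4 i) < 0.46 for the slope of u and sum 1/(4
  i^(3/2)) < 0.39 for its size, and 0.46 + 0.39 = 17/20. No invariant density is constructed; the
  iterates of 1 under \<open>L\<close>, whose Lipschitz constants stay bounded, stand in for it.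
  Splitting p into three pieces avoids integration up to the irrational ends of I_i: the integral of
  p over I_i equals that of the i-th summand of \<open>L p\<close> over all of [0,1), where the
  nearby P_i has a rational integral. Since the contraction acts on Lipschitz constants, p - L p has
  to be small in that sense and not only pointwise. Rounding errors are therefore kept as
  polynomials with small coefficients, which yield a sup bound and a Lipschitz bound at once. At
  scale 2^222, about 6.7 * 10^66, the total error 2 * 10^15 amounts to about 3 * 10^-52.\<close>

abbreviation unit_meas :: "real measure" where
  "unit_meas \<equiv> restrict_space lborel {0..<1}"

definition branch :: "nat \<Rightarrow> real \<Rightarrow> real" where
  "branch i x = sqrt (x + real i) - 1"

text \<open>A digit indicator selects exactly one inverse branch, so each summand of the transfer
  operator is kept as an operator of its own.\<close>

definition btransfer :: "nat \<Rightarrow> (real \<Rightarrow> real) \<Rightarrow> real \<Rightarrow> real" where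
  "btransfer i u x = u (branch i x) / (2 * sqrt (x + real i))"

definition transfer :: "(real \<Rightarrow> real) \<Rightarrow> real \<Rightarrow> real" where
  "transfer u x = (\<Sum>i\<in>{1,2,3}. btransfer i u x)"

definition digit_ind :: "nat \<Rightarrow> real \<Rightarrow> real" where
  "digit_ind i x = (if BR_index x = i then 1 else 0)"

section \<open>Lebesgue measure on [0,1), the map and its inverse branches\<close>

interpretation U: prob_space unit_meas
  by (rule prob_space_restrict_space) (auto simp: emeasure_lborel_Ico)

lemma space_U [simp]: "space unit_meas = {0..<1}"
  by (simp add: space_restrict_space)

lemma prob_U [simp]: "measure unit_meas {0..<1} = 1"
  using U.prob_space by simp

lemma borel_U_iff: "u \<in> borel_measurable unit_meas \<longleftrightarrow> (\<lambda>x. indicator {0..<1} x * u x) \<in> borel_measurable borel"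
  for u :: "real \<Rightarrow> real"
  by (subst borel_measurable_restrict_space_iff) (auto simp: real_scaleR_def mult.commute)

lemma integral_U: "integral\<^sup>L unit_meas u = integral\<^sup>L lborel (\<lambda>x. indicator {0..<1} x * u x)"
  for u :: "real \<Rightarrow> real"
  by (subst integral_restrict_space) auto

lemma integrable_U: "u \<in> borel_measurable unit_meas \<Longrightarrow> (\<And>x. x \<in> {0..<1} \<Longrightarrow> \<bar>u x\<bar> \<le> B) \<Longrightarrow> integrable unit_meas u"
  for u :: "real \<Rightarrow> real"
  by (rule U.integrable_const_bound[where B=B]) auto

lemma sqrt_digit_bounds:
  assumes "i \<in> {1,2,3}"
  shows "1 \<le> sqrt (real i)" "sqrt (real i + 1) \<le> 2"
  using assms by (auto intro!: real_le_lsqrt)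

lemma branch_mem:
  assumes "i \<in> {1,2,3}" "x \<in> {0..<1}"
  shows "branch i x \<in> {sqrt (real i) - 1..<sqrt (real i + 1) - 1}" "branch i x \<in> {0..<1}"
proof -
  show *: "branch i x \<in> {sqrt (real i) - 1..<sqrt (real i + 1) - 1}"
    using assms by (auto simp: branch_def)
  show "branch i x \<in> {0..<1}" using * sqrt_digit_bounds[OF assms(1)] unfolding atLeastLessThan_iff by linarith
qed

lemma BR_index_iff:
  assumes "i \<in> {1,2,3}" "x \<in> {0..<1}"
  shows "BR_index x = i \<longleftrightarrow> x \<in> {sqrt (real i) - 1..<sqrt (real i + 1) - 1}"
proof -
  have "sqrt 2 < sqrt (3::real)" by simp
  then show ?thesis using assms by (auto simp: BR_index_def simp del: real_sqrt_less_iff)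
qed

lemma BR_index_range: "BR_index x \<in> {1,2,3}"
  by (auto simp: BR_index_def)

lemma BR_map_eq: "BR_map x = (x + 1)\<^sup>2 - real (BR_index x)"
  by (simp add: BR_map_def power2_eq_square algebra_simps)

lemma BR_map_mem:
  assumes "x \<in> {0..<1}" shows "BR_map x \<in> {0..<1}"
proof -
  define i where "i = BR_index x"
  have i: "i \<in> {1,2,3}" unfolding i_def by (rule BR_index_range)
  then have "x \<in> {sqrt (real i) - 1..<sqrt (real i + 1) - 1}"
    using BR_index_iff[OF i assms] i_def by simp
  then have "sqrt (real i) \<le> x + 1" "x + 1 < sqrt (real i + 1)" by auto
  then have "(sqrt (real i))\<^sup>2 \<le> (x + 1)\<^sup>2" "(x + 1)\<^sup>2 < (sqrt (real i + 1))\<^sup>2"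
    using assms by (intro power_mono power_strict_mono; simp)+
  then show ?thesis by (simp add: BR_map_eq i_def)
qed

lemma BR_index_measurable [measurable]: "BR_index \<in> borel \<rightarrow>\<^sub>M count_space UNIV"
  unfolding BR_index_def by measurable

lemma BR_map_borel [measurable]: "BR_map \<in> borel_measurable borel"
  unfolding BR_map_def by measurable

lemma BR_map_measurable [measurable]: "BR_map \<in> unit_meas \<rightarrow>\<^sub>M unit_meas"
  by (rule measurable_restrict_space2)
     (auto intro!: BR_map_mem measurable_restrict_space1 simp del: atLeastLessThan_iff)

lemma digit_ind_borel: "digit_ind i \<in> borel_measurable borel"
  unfolding digit_ind_def by measurable

lemma digit_ind_measurable [measurable]: "digit_ind i \<in> borel_measurable unit_meas"
  by (rule measurable_restrict_space1) (use digit_ind_borel in simp)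

lemma digit_ind_bounds: "0 \<le> digit_ind i x" "digit_ind i x \<le> 1" "\<bar>digit_ind i x\<bar> \<le> 1"
  by (auto simp: digit_ind_def)

text \<open>Substitution z = \<open>branch i x\<close>: the branch maps [0,1) onto I_i, inverts the
  map there, and has derivative 1 / (2 * sqrt (x + i)). Both functions are extended by zero so that
  the substitution can be carried out on the whole line.\<close>

lemma integral_branch:
  assumes i: "i \<in> {1,2,3}"
    and u [measurable]: "u \<in> borel_measurable unit_meas" and ub: "\<And>x. x \<in> {0..<1} \<Longrightarrow> \<bar>u x\<bar> \<le> B"
    and v [measurable]: "v \<in> borel_measurable unit_meas" and vb: "\<And>x. x \<in> {0..<1} \<Longrightarrow> \<bar>v x\<bar> \<le> C"
  shows "(\<integral>x. digit_ind i x * u x * v (BR_map x) \<partial>unit_meas) = (\<integral>x. btransfer i u x * v x \<partial>unit_meas)"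
proof -
  define J where "J = {sqrt (real i) - 1..<sqrt (real i + 1) - 1}"
  define u0 where "u0 = (\<lambda>x. indicator {0..<1} x * u x)"
  define v0 where "v0 = (\<lambda>x. indicator {0..<1} x * v x)"
  have [measurable]: "u0 \<in> borel_measurable borel" "v0 \<in> borel_measurable borel"
    using u v unfolding u0_def v0_def borel_U_iff .
  have [measurable]: "J \<in> sets borel" by (simp add: J_def)
  define f where "f = (\<lambda>z. indicator J z * u0 z * v0 ((z + 1)\<^sup>2 - real i))"
  have [measurable]: "f \<in> borel_measurable borel" unfolding f_def by measurable
  have fb: "\<bar>f z\<bar> \<le> B * C" for z
  proof -
    have "0 \<le> B" "0 \<le> C" using ub[of 0] vb[of 0] by auto
    moreover have "\<bar>u0 z\<bar> \<le> B" "\<bar>v0 ((z + 1)\<^sup>2 - real i)\<bar> \<le> C"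
      using ub[of z] vb[of "(z + 1)\<^sup>2 - real i"] calculation by (auto simp: u0_def v0_def indicator_def)
    ultimately show ?thesis
      by (auto simp: f_def abs_mult indicator_def intro!: mult_mono)
  qed
  have g0: "branch i 0 = sqrt (real i) - 1" "branch i 1 = sqrt (real i + 1) - 1"
    by (auto simp: branch_def add.commute)
  have "(LBINT z. f z * indicator {branch i 0..branch i 1} z)
      = (LBINT x. f (branch i x) * (1 / (2 * sqrt (x + real i))) * indicator {0..1} x)"
  proof (rule integral_substitution)
    have "emeasure lborel {branch i 0..branch i 1} < \<infinity>" by (simp add: emeasure_lborel_Icc_eq)
    then show "set_integrable lborel {branch i 0..branch i 1} f"
      unfolding set_integrable_def
      by (intro integrableI_bounded_set_indicator[where B="B * C"]) (use fb in auto)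
    show "(branch i has_real_derivative 1 / (2 * sqrt (x + real i))) (at x)" if "x \<in> {0..1}" for x
      unfolding branch_def using that i by (auto intro!: derivative_eq_intros simp: field_simps)
    show "continuous_on {0..1} (\<lambda>x. 1 / (2 * sqrt (x + real i)))"
      using i by (intro continuous_intros) auto
  qed auto
  moreover have "f z * indicator {branch i 0..branch i 1} z = indicator {0..<1} z * (digit_ind i z * u z * v (BR_map z))" for z
  proof (cases "z \<in> J")
    case True
    have z: "z \<in> {0..<1}" using True sqrt_digit_bounds[OF i] unfolding J_def atLeastLessThan_iff by linarith
    have ix: "BR_index z = i" using True BR_index_iff[OF i z] by (simp add: J_def)
    have "(z + 1)\<^sup>2 - real i = BR_map z" by (simp add: BR_map_eq ix)
    then show ?thesis
      using True z BR_map_mem[OF z] by (simp add: f_def u0_def v0_def digit_ind_def ix g0 J_def)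
  next
    case False
    then have "z \<in> {0..<1} \<Longrightarrow> BR_index z \<noteq> i" using BR_index_iff[OF i, of z] by (simp add: J_def)
    then show ?thesis using False by (auto simp: f_def digit_ind_def indicator_def)
  qed
  moreover have "f (branch i x) * (1 / (2 * sqrt (x + real i))) * indicator {0..1} x
      = indicator {0..<1} x * (btransfer i u x * v x)" for x
  proof (cases "x \<in> {0..<1}")
    case True
    then have "branch i x \<in> J" "branch i x \<in> {0..<1}" using branch_mem[OF i True] by (auto simp: J_def)
    moreover have "(branch i x + 1)\<^sup>2 - real i = x" using True by (simp add: branch_def)
    ultimately show ?thesis using True
      by (simp add: f_def u0_def v0_def btransfer_def indicator_def)
  next
    case False
    \<comment> \<open>\<open>J\<close> is half-open, so \<open>f\<close> vanishes at the right end,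
      and the closed interval of the substitution rule adds nothing.\<close>
    have "f (branch i 1) = 0" by (simp add: f_def J_def g0)
    then show ?thesis using False by (cases "x = 1") (auto simp: indicator_def)
  qed
  ultimately show ?thesis unfolding integral_U by simp
qed

section \<open>Lipschitz estimates for the transfer operator\<close>

lemma lipschitz_borel_U:
  fixes u :: "real \<Rightarrow> real"
  assumes "C-lipschitz_on {0..<1} u"
  shows "u \<in> borel_measurable unit_meas"
proof -
  have "u \<in> borel_measurable (restrict_space borel {0..<1})"
    using assms lipschitz_on_continuous_on by (intro borel_measurable_continuous_on_restrict) blast
  then show ?thesis
    by (simp cong: measurable_cong_sets add: measurable_cong_sets[OF sets_restrict_space_cong[OF sets_lborel] refl])
qed

lemma lipschitz_unit_bounded:
  fixes u :: "real \<Rightarrow> real"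
  assumes "C-lipschitz_on {0..<1} u" "x \<in> {0..<1}"
  shows "\<bar>u x\<bar> \<le> \<bar>u 0\<bar> + C"
proof -
  have "\<bar>u x - u 0\<bar> \<le> C * \<bar>x - 0\<bar>"
    using lipschitz_onD[OF assms(1), of x 0] assms(2) by (auto simp: dist_real_def)
  also have "\<dots> \<le> C * 1"
    using assms lipschitz_on_nonneg[OF assms(1)] by (intro mult_left_mono) auto
  finally show ?thesis by linarith
qed

lemma lipschitz_integrable_U:
  fixes u :: "real \<Rightarrow> real"
  assumes "C-lipschitz_on {0..<1} u"
  shows "integrable unit_meas u"
  using lipschitz_borel_U[OF assms] lipschitz_unit_bounded[OF assms] by (rule integrable_U)

lemma integral_U_le:
  fixes u :: "real \<Rightarrow> real"
  assumes "u \<in> borel_measurable unit_meas" "\<And>x. x \<in> {0..<1} \<Longrightarrow> \<bar>u x\<bar> \<le> B"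
  shows "\<bar>\<integral>x. u x \<partial>unit_meas\<bar> \<le> B"
proof -
  have "\<bar>\<integral>x. u x \<partial>unit_meas\<bar> \<le> (\<integral>x. \<bar>u x\<bar> \<partial>unit_meas)" by (rule integral_abs_bound)
  also have "\<dots> \<le> (\<integral>x. B \<partial>unit_meas)"
    using assms by (intro integral_mono integrable_abs integrable_U[OF assms]) auto
  also have "\<dots> = B" by (simp add: U.prob_space)
  finally show ?thesis .
qed

text \<open>With mean zero, u x is the average of u x - u y over y, and points of the unit interval
  are at distance at most 1. This lets one number control both slope and size.\<close>

lemma lipschitz_mean_zero_bound:
  fixes u :: "real \<Rightarrow> real"
  assumes u: "C-lipschitz_on {0..<1} u" and "(\<integral>x. u x \<partial>unit_meas) = 0" and x: "x \<in> {0..<1}"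
  shows "\<bar>u x\<bar> \<le> C"
proof -
  have int: "integrable unit_meas u" by (rule lipschitz_integrable_U[OF u])
  have "u x = (\<integral>y. u x - u y \<partial>unit_meas)"
    using assms(2) int by (simp add: U.prob_space)
  moreover have "\<bar>\<integral>y. u x - u y \<partial>unit_meas\<bar> \<le> C"
  proof (rule integral_U_le)
    fix y :: real assume y: "y \<in> {0..<1}"
    have "\<bar>u x - u y\<bar> \<le> C * \<bar>x - y\<bar>"
      using lipschitz_onD[OF u x y] by (simp add: dist_real_def)
    also have "\<dots> \<le> C * 1"
      using x y lipschitz_on_nonneg[OF u] by (intro mult_left_mono) auto
    finally show "\<bar>u x - u y\<bar> \<le> C" by simp
  qed (use lipschitz_borel_U[OF u] in measurable)
  ultimately show ?thesis by simp
qed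

text \<open>Product rule with two factors: the branch has slope at most 1 / (2 * sqrt i), and the
  weight is at most 1 / (2 * sqrt i) with slope at most 1 / (4 * i * sqrt i), as sqrt (x + i) is at
  least sqrt i.\<close>

lemma btransfer_lipschitz:
  assumes i: "i \<in> {1,2,3}" and u: "C-lipschitz_on {0..<1} u"
    and B: "\<And>x. x \<in> {0..<1} \<Longrightarrow> \<bar>u x\<bar> \<le> B"
  shows "(C / (4 * real i) + B / (4 * (real i * sqrt (real i))))-lipschitz_on {0..<1} (btransfer i u)"
proof (rule lipschitz_onI)
  have C: "0 \<le> C" using lipschitz_on_nonneg[OF u] .
  have B0: "0 \<le> B" using B[of 0] by auto
  show "0 \<le> C / (4 * real i) + B / (4 * (real i * sqrt (real i)))" using C B0 by simp
  fix x y :: real assume x: "x \<in> {0..<1}" and y: "y \<in> {0..<1}"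
  define r where "r = sqrt (real i)"
  define a where "a = sqrt (x + real i)"
  define b where "b = sqrt (y + real i)"
  have r: "r \<ge> 1" "r * r = real i" using sqrt_digit_bounds(1)[OF i] by (auto simp: r_def)
  have a: "a \<ge> r" "b \<ge> r" using x y by (auto simp: r_def a_def b_def)
  have "(a - b) * (a + b) = x - y" using x y by (simp add: a_def b_def algebra_simps)
  then have "\<bar>a - b\<bar> * (a + b) = \<bar>x - y\<bar>" using a r by (metis abs_mult abs_of_nonneg add_nonneg_nonneg order_trans zero_le_one)
  moreover have "\<bar>a - b\<bar> * (2 * r) \<le> \<bar>a - b\<bar> * (a + b)" using a by (intro mult_left_mono) auto
  ultimately have ab: "\<bar>a - b\<bar> \<le> \<bar>x - y\<bar> / (2 * r)" using r by (simp add: field_simps)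
  let ?p = "u (branch i x)" and ?q = "u (branch i y)"
  have "\<bar>?p - ?q\<bar> \<le> C * \<bar>a - b\<bar>"
    using lipschitz_onD[OF u branch_mem(2)[OF i x] branch_mem(2)[OF i y]]
    by (simp add: dist_real_def branch_def a_def b_def)
  also have "\<dots> \<le> C * (\<bar>x - y\<bar> / (2 * r))" using ab C by (rule mult_left_mono)
  finally have pq: "\<bar>?p - ?q\<bar> \<le> C * (\<bar>x - y\<bar> / (2 * r))" .
  have "\<bar>?p - ?q\<bar> / (2 * a) \<le> (C * (\<bar>x - y\<bar> / (2 * r))) / (2 * r)"
    using pq a r C by (intro frac_le) auto
  then have 1: "\<bar>(?p - ?q) / (2 * a)\<bar> \<le> C / (4 * real i) * \<bar>x - y\<bar>"
    using a r(1) by (simp add: r(2)[symmetric])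
  have "1 / (2 * a) - 1 / (2 * b) = (b - a) / (2 * (a * b))" using a r by (simp add: field_simps)
  then have "\<bar>1 / (2 * a) - 1 / (2 * b)\<bar> = \<bar>a - b\<bar> / (2 * (a * b))" using a r by (simp add: abs_mult)
  also have "\<dots> \<le> (\<bar>x - y\<bar> / (2 * r)) / (2 * (r * r))"
    using ab a r i by (intro frac_le mult_left_mono mult_mono) auto
  finally have w: "\<bar>1 / (2 * a) - 1 / (2 * b)\<bar> \<le> 1 / (4 * (real i * r)) * \<bar>x - y\<bar>"
    by (simp add: r(2)[symmetric] mult.assoc)
  have "\<bar>?q * (1 / (2 * a) - 1 / (2 * b))\<bar> \<le> B * (1 / (4 * (real i * r)) * \<bar>x - y\<bar>)"
    unfolding abs_mult using w B[OF branch_mem(2)[OF i y]] B0 by (intro mult_mono) auto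
  moreover have "btransfer i u x - btransfer i u y = (?p - ?q) / (2 * a) + ?q * (1 / (2 * a) - 1 / (2 * b))"
    by (simp add: btransfer_def a_def b_def diff_divide_distrib algebra_simps)
  ultimately have "\<bar>btransfer i u x - btransfer i u y\<bar>
      \<le> C / (4 * real i) * \<bar>x - y\<bar> + B * (1 / (4 * (real i * r)) * \<bar>x - y\<bar>)"
    using 1 by linarith
  then show "dist (btransfer i u x) (btransfer i u y)
      \<le> (C / (4 * real i) + B / (4 * (real i * sqrt (real i)))) * dist x y"
    by (simp add: dist_real_def r_def distrib_right)
qed

lemma transfer_unfold: "transfer u = (\<lambda>x. btransfer 1 u x + btransfer 2 u x + btransfer 3 u x)"
  by (simp add: transfer_def fun_eq_iff)

text \<open>The factors are 1/4 + 1/8 + 1/12 = 11/24 < 23/50 and, with sqrt 2 >= 7/5 and sqrt 3 >=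
  17/10, 1/4 + 5/56 + 5/102 < 39/100. For B = C they add up to 17/20.\<close>

lemma transfer_lipschitz:
  assumes u: "C-lipschitz_on {0..<1} u" and B: "\<And>x. x \<in> {0..<1} \<Longrightarrow> \<bar>u x\<bar> \<le> B"
  shows "(23/50 * C + 39/100 * B)-lipschitz_on {0..<1} (transfer u)"
proof -
  have C: "0 \<le> C" using lipschitz_on_nonneg[OF u] .
  have B0: "0 \<le> B" using B[of 0] by auto
  have "(C / (4 * real 1) + B / (4 * (real 1 * sqrt (real 1))) + (C / (4 * real 2) + B / (4 * (real 2 * sqrt (real 2))))
      + (C / (4 * real 3) + B / (4 * (real 3 * sqrt (real 3)))))-lipschitz_on {0..<1} (transfer u)" (is "?L-lipschitz_on _ _")
    unfolding transfer_unfold by (intro lipschitz_on_add btransfer_lipschitz u B) auto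
  moreover have "?L \<le> 23/50 * C + 39/100 * B"
  proof -
    have "7 / 5 \<le> sqrt (2::real)" "17 / 10 \<le> sqrt (3::real)"
      by (rule real_le_rsqrt; simp add: power2_eq_square)+
    then have "B / (4 * (2 * sqrt 2)) \<le> B / (4 * (2 * (7 / 5)))" "B / (4 * (3 * sqrt 3)) \<le> B / (4 * (3 * (17 / 10)))"
      using B0 by (intro divide_left_mono; simp)+
    then show ?thesis using B0 C by simp
  qed
  ultimately show ?thesis using lipschitz_on_leI by (meson lipschitz_on_mono order_refl)
qed

section \<open>Duality between the map and the transfer operator\<close>

lemma integral_digit_transfer:
  assumes i: "i \<in> {1,2,3}" and u: "C-lipschitz_on {0..<1} u"
    and v: "v \<in> borel_measurable unit_meas" and vb: "\<And>x. x \<in> {0..<1} \<Longrightarrow> \<bar>v x\<bar> \<le> K"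
  shows "(\<integral>x. digit_ind i x * u x * v (BR_map x) \<partial>unit_meas) = (\<integral>x. btransfer i u x * v x \<partial>unit_meas)"
  by (rule integral_branch[OF i lipschitz_borel_U[OF u] lipschitz_unit_bounded[OF u] v vb])

text \<open>The three digit indicators sum to 1, so the branchwise substitutions add up to the
  duality of composition with the map and the transfer operator under Lebesgue measure.\<close>

lemma integral_transfer:
  assumes u: "C-lipschitz_on {0..<1} u"
    and v [measurable]: "v \<in> borel_measurable unit_meas" and vb: "\<And>x. x \<in> {0..<1} \<Longrightarrow> \<bar>v x\<bar> \<le> K"
  shows "(\<integral>x. u x * v (BR_map x) \<partial>unit_meas) = (\<integral>x. transfer u x * v x \<partial>unit_meas)"
proof -
  note [measurable] = lipschitz_borel_U[OF u]
  have K: "0 \<le> K" using vb[of 0] by auto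
  have int: "integrable unit_meas (\<lambda>x. digit_ind i x * u x * v (BR_map x))" for i
  proof (rule integrable_U)
    fix x :: real assume x: "x \<in> {0..<1}"
    have "\<bar>digit_ind i x\<bar> * \<bar>u x\<bar> * \<bar>v (BR_map x)\<bar> \<le> 1 * (\<bar>u 0\<bar> + C) * K"
      using lipschitz_unit_bounded[OF u x] vb[OF BR_map_mem[OF x]] lipschitz_on_nonneg[OF u] digit_ind_bounds(3)
      by (intro mult_mono) auto
    then show "\<bar>digit_ind i x * u x * v (BR_map x)\<bar> \<le> (\<bar>u 0\<bar> + C) * K" by (simp add: abs_mult)
  qed measurable
  have int2: "integrable unit_meas (\<lambda>x. btransfer i u x * v x)" if i: "i \<in> {1,2,3}" for i
  proof -
    obtain D where D: "D-lipschitz_on {0..<1} (btransfer i u)"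
      using btransfer_lipschitz[OF i u lipschitz_unit_bounded[OF u]] by blast
    note [measurable] = lipschitz_borel_U[OF D]
    show ?thesis
    proof (rule integrable_U)
      fix x :: real assume x: "x \<in> {0..<1}"
      show "\<bar>btransfer i u x * v x\<bar> \<le> (\<bar>btransfer i u 0\<bar> + D) * K"
        unfolding abs_mult using lipschitz_unit_bounded[OF D x] vb[OF x] K by (intro mult_mono) auto
    qed measurable
  qed
  have "u x * v (BR_map x) = (\<Sum>i\<in>{1,2,3}. digit_ind i x * u x * v (BR_map x))" for x
    using BR_index_range[of x] by (auto simp: digit_ind_def)
  then have "(\<integral>x. u x * v (BR_map x) \<partial>unit_meas) = (\<Sum>i\<in>{1,2,3}. \<integral>x. digit_ind i x * u x * v (BR_map x) \<partial>unit_meas)"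
    using int by (subst Bochner_Integration.integral_sum[symmetric]) auto
  also have "\<dots> = (\<Sum>i\<in>{1,2,3}. \<integral>x. btransfer i u x * v x \<partial>unit_meas)"
    by (intro sum.cong refl integral_digit_transfer[OF _ u v vb])
  also have "\<dots> = (\<integral>x. (\<Sum>i\<in>{1,2,3}. btransfer i u x * v x) \<partial>unit_meas)"
    using int2 by (subst Bochner_Integration.integral_sum) auto
  finally show ?thesis unfolding transfer_def sum_distrib_right .
qed


lemma transfer_lipschitz_ex:
  assumes "C-lipschitz_on {0..<1} u"
  shows "\<exists>D. D-lipschitz_on {0..<1} (transfer u)"
  using transfer_lipschitz[OF assms lipschitz_unit_bounded[OF assms]] by blast

lemma transfer_pow_lipschitz_ex:
  assumes "C-lipschitz_on {0..<1} u"
  shows "\<exists>D. D-lipschitz_on {0..<1} ((transfer ^^ n) u)"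
  using assms by (induction n) (auto intro: transfer_lipschitz_ex)

lemma BR_map_pow_mem: "x \<in> {0..<1} \<Longrightarrow> (BR_map ^^ n) x \<in> {0..<1}"
  by (induction n) (auto intro: BR_map_mem simp del: atLeastLessThan_iff)

lemma BR_map_pow_measurable [measurable]: "(BR_map ^^ n) \<in> unit_meas \<rightarrow>\<^sub>M unit_meas"
  by (induction n) (simp_all add: measurable_id[unfolded id_def[symmetric]] measurable_comp[OF _ BR_map_measurable] id_def)

lemma integral_transfer_pow:
  assumes u: "C-lipschitz_on {0..<1} u"
    and v [measurable]: "v \<in> borel_measurable unit_meas" and vb: "\<And>x. x \<in> {0..<1} \<Longrightarrow> \<bar>v x\<bar> \<le> K"
  shows "(\<integral>x. u x * v ((BR_map ^^ n) x) \<partial>unit_meas) = (\<integral>x. (transfer ^^ n) u x * v x \<partial>unit_meas)"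
  using u
proof (induction n arbitrary: u C)
  case (Suc n)
  obtain D where D: "D-lipschitz_on {0..<1} (transfer u)" using transfer_lipschitz_ex[OF Suc.prems] by blast
  have "(\<integral>x. u x * v ((BR_map ^^ Suc n) x) \<partial>unit_meas) = (\<integral>x. u x * v ((BR_map ^^ n) (BR_map x)) \<partial>unit_meas)"
    by (simp add: funpow_swap1)
  also have "\<dots> = (\<integral>x. transfer u x * v ((BR_map ^^ n) x) \<partial>unit_meas)"
    by (rule integral_transfer[OF Suc.prems, where K=K]) (use vb BR_map_pow_mem in \<open>auto simp del: atLeastLessThan_iff\<close>)
  also have "\<dots> = (\<integral>x. (transfer ^^ n) (transfer u) x * v x \<partial>unit_meas)"
    by (rule Suc.IH[OF D])
  finally show ?case by (simp add: funpow_swap1)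
qed simp

lemma integral_transfer_pow_1:
  assumes "C-lipschitz_on {0..<1} u"
  shows "(\<integral>x. (transfer ^^ n) u x \<partial>unit_meas) = (\<integral>x. u x \<partial>unit_meas)"
  using integral_transfer_pow[OF assms, of "\<lambda>_. 1" 1 n] by simp

text \<open>The transfer operator preserves the integral, so every iterate again has mean zero and
  its size may be bounded by its Lipschitz constant at each step.\<close>

lemma transfer_pow_contraction:
  assumes "C-lipschitz_on {0..<1} u" "(\<integral>x. u x \<partial>unit_meas) = 0"
  shows "((17/20)^n * C)-lipschitz_on {0..<1} ((transfer ^^ n) u)"
proof (induction n)
  case (Suc n)
  have "(\<integral>x. (transfer ^^ n) u x \<partial>unit_meas) = 0"
    using integral_transfer_pow_1[OF assms(1)] assms(2) by simp
  from transfer_lipschitz[OF Suc.IH lipschitz_mean_zero_bound[OF Suc.IH this]]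
  show ?case by (simp add: algebra_simps)
qed (use assms in simp)

lemma transfer_lincomb:
  "transfer (\<lambda>x. u x - c * w x) = (\<lambda>x. transfer u x - c * transfer w x)"
  by (simp add: transfer_unfold btransfer_def fun_eq_iff diff_divide_distrib algebra_simps)

lemma transfer_pow_lincomb:
  "(transfer ^^ n) (\<lambda>x. u x - c * w x) = (\<lambda>x. (transfer ^^ n) u x - c * (transfer ^^ n) w x)"
  by (induction n) (simp_all add: transfer_lincomb)

section \<open>Iterated densities and the limiting frequencies\<close>

text \<open>The density of the image of Lebesgue measure under n steps of the map.\<close>

definition dens :: "nat \<Rightarrow> real \<Rightarrow> real" where
  "dens n = (transfer ^^ n) (\<lambda>_. 1)"

text \<open>Subtracting the mean leaves a mean-zero function with the same Lipschitz constant, and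
  the subtracted constant evolves into the mean times \<open>dens n\<close>.\<close>

lemma transfer_pow_approx:
  assumes u: "C-lipschitz_on {0..<1} u" and x: "x \<in> {0..<1}"
  shows "\<bar>(transfer ^^ n) u x - (\<integral>y. u y \<partial>unit_meas) * dens n x\<bar> \<le> (17/20)^n * C"
proof -
  let ?m = "\<integral>y. u y \<partial>unit_meas"
  let ?w = "\<lambda>y. u y - ?m * 1"
  have w: "C-lipschitz_on {0..<1} ?w"
    using lipschitz_on_diff[OF u lipschitz_on_constant] by simp
  have "(\<integral>y. ?w y \<partial>unit_meas) = 0" using lipschitz_integrable_U[OF u] by simp
  from transfer_pow_contraction[OF w this, of n] integral_transfer_pow_1[OF w, of n] this
  have "\<bar>(transfer ^^ n) ?w x\<bar> \<le> (17/20)^n * C"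
    using lipschitz_mean_zero_bound x by metis
  then show ?thesis unfolding transfer_pow_lincomb dens_def .
qed

lemma integral_dens [simp]: "(\<integral>x. dens n x \<partial>unit_meas) = 1"
  unfolding dens_def by (subst integral_transfer_pow_1[OF lipschitz_on_constant]) simp

lemma dens_lipschitz: "7-lipschitz_on {0..<1} (dens n)"
proof (induction n)
  case 0
  then show ?case using lipschitz_on_mono[OF lipschitz_on_constant, of "{0..<1::real}" "{0..<1}" 7 "1::real"] by (simp add: dens_def)
next
  case (Suc n)
  have w: "7-lipschitz_on {0..<1} (\<lambda>x. dens n x - 1 * 1)"
    using lipschitz_on_diff[OF Suc.IH lipschitz_on_constant] by simp
  have "(\<integral>x. dens n x - 1 * 1 \<partial>unit_meas) = 0"
    using lipschitz_integrable_U[OF Suc.IH] by simp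
  from transfer_lipschitz[OF w lipschitz_mean_zero_bound[OF w this]]
  have "(23/50 * 7 + 39/100 * 7)-lipschitz_on {0..<1} (transfer (\<lambda>x. dens n x - 1 * 1))" by simp
  from lipschitz_on_add[OF this transfer_lipschitz[OF lipschitz_on_constant, of 1 1]]
  \<comment> \<open>The mean-zero part contributes 17/20 * 7, the constant 1 contributes 39/100; the
    sum 6.34 is below 7, which closes the induction.\<close>
  have "(23/50 * 7 + 39/100 * 7 + 39/100)-lipschitz_on {0..<1} (dens (Suc n))"
    unfolding transfer_lincomb by (simp add: dens_def)
  then show ?case by (rule lipschitz_on_mono) auto
qed

lemma dens_bounded: "x \<in> {0..<1} \<Longrightarrow> \<bar>dens n x\<bar> \<le> 8"
proof -
  assume x: "x \<in> {0..<1}"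
  have w: "7-lipschitz_on {0..<1} (\<lambda>x. dens n x - 1)"
    using lipschitz_on_diff[OF dens_lipschitz lipschitz_on_constant] by simp
  have "(\<integral>x. dens n x - 1 \<partial>unit_meas) = 0"
    using lipschitz_integrable_U[OF dens_lipschitz] by simp
  from lipschitz_mean_zero_bound[OF w this x] show ?thesis by linarith
qed

text \<open>The Lebesgue measure of the points whose digit number n + 1 is i; see
  \<open>dmass_eq\<close>.\<close>

definition dmass :: "nat \<Rightarrow> nat \<Rightarrow> real" where
  "dmass i n = (\<integral>x. digit_ind i x * dens n x \<partial>unit_meas)"

definition freq :: "nat \<Rightarrow> real" where
  "freq i = lim (dmass i)"

lemma integrable_digit_mult:
  assumes u: "C-lipschitz_on {0..<1} u"
  shows "integrable unit_meas (\<lambda>x. digit_ind i x * u x)"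
proof (rule integrable_U)
  show "(\<lambda>x. digit_ind i x * u x) \<in> borel_measurable unit_meas"
    using lipschitz_borel_U[OF u] by measurable
  fix x :: real assume "x \<in> {0..<1}"
  then have "\<bar>digit_ind i x\<bar> * \<bar>u x\<bar> \<le> 1 * (\<bar>u 0\<bar> + C)"
    using lipschitz_unit_bounded[OF u] digit_ind_bounds by (intro mult_mono) auto
  then show "\<bar>digit_ind i x * u x\<bar> \<le> \<bar>u 0\<bar> + C" by (simp add: abs_mult)
qed

lemma digit_transfer_pow_approx:
  assumes u: "C-lipschitz_on {0..<1} u"
  shows "\<bar>(\<integral>x. digit_ind i x * (transfer ^^ n) u x \<partial>unit_meas) - (\<integral>y. u y \<partial>unit_meas) * dmass i n\<bar> \<le> (17/20)^n * C"
proof -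
  let ?m = "\<integral>y. u y \<partial>unit_meas"
  obtain D where D: "D-lipschitz_on {0..<1} ((transfer ^^ n) u)" using transfer_pow_lipschitz_ex[OF u] by blast
  note [measurable] = lipschitz_borel_U[OF D] lipschitz_borel_U[OF dens_lipschitz[of n]]
  have "(\<integral>x. digit_ind i x * (transfer ^^ n) u x \<partial>unit_meas) - ?m * dmass i n
      = (\<integral>x. digit_ind i x * (transfer ^^ n) u x - ?m * (digit_ind i x * dens n x) \<partial>unit_meas)"
    unfolding dmass_def using integrable_digit_mult[OF D] integrable_digit_mult[OF dens_lipschitz] by simp
  also have "\<dots> = (\<integral>x. digit_ind i x * ((transfer ^^ n) u x - ?m * dens n x) \<partial>unit_meas)"
    by (simp add: algebra_simps)
  also have "\<bar>\<dots>\<bar> \<le> (17/20)^n * C"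
  proof (rule integral_U_le)
    fix x :: real assume x: "x \<in> {0..<1}"
    have "\<bar>digit_ind i x\<bar> * \<bar>(transfer ^^ n) u x - ?m * dens n x\<bar> \<le> 1 * ((17/20)^n * C)"
      using transfer_pow_approx[OF u x, of n] digit_ind_bounds by (intro mult_mono) auto
    then show "\<bar>digit_ind i x * ((transfer ^^ n) u x - ?m * dens n x)\<bar> \<le> (17/20)^n * C" by (simp add: abs_mult)
  qed measurable
  finally show ?thesis .
qed

text \<open>\<open>dens (n + k)\<close> is the n-th iterate of \<open>dens k\<close>, which has
  integral 1 and Lipschitz constant 7 for every k, so the bound is uniform in k.\<close>

lemma dmass_Cauchy: "\<bar>dmass i (n + k) - dmass i n\<bar> \<le> (17/20)^n * 7"
proof -
  have "(transfer ^^ n) (dens k) = dens (n + k)" by (simp add: dens_def funpow_add)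
  then show ?thesis
    using digit_transfer_pow_approx[OF dens_lipschitz[of k], of i n] by (simp add: dmass_def)
qed

lemma dmass_tendsto: "dmass i \<longlonglongrightarrow> freq i"
proof -
  have "Cauchy (dmass i)"
  proof (rule metric_CauchyI)
    fix e :: real assume e: "e > 0"
    have "(\<lambda>n. (17/20)^n * 7 :: real) \<longlonglongrightarrow> 0"
      by (intro tendsto_mult_left_zero LIMSEQ_power_zero) simp
    then have "\<forall>\<^sub>F n in sequentially. (17/20)^n * 7 < e / 2"
      by (rule order_tendstoD(2)) (use e in simp)
    then obtain N where N: "(17/20)^N * 7 < e / 2" by (auto simp: eventually_sequentially)
    have "dist (dmass i m) (dmass i n) < e" if "m \<ge> N" "n \<ge> N" for m n
      using dmass_Cauchy[of i N "m - N"] dmass_Cauchy[of i N "n - N"] N that by (simp add: dist_real_def)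
    then show "\<exists>M. \<forall>m\<ge>M. \<forall>n\<ge>M. dist (dmass i m) (dmass i n) < e" by blast
  qed
  then show ?thesis unfolding freq_def by (simp add: Cauchy_convergent_iff convergent_LIMSEQ_iff)
qed

lemma dmass_freq: "\<bar>dmass i n - freq i\<bar> \<le> (17/20)^n * 7"
proof -
  have "(\<lambda>k. \<bar>dmass i (n + k) - dmass i n\<bar>) \<longlonglongrightarrow> \<bar>freq i - dmass i n\<bar>"
    using LIMSEQ_ignore_initial_segment[OF dmass_tendsto, of i n]
    by (intro tendsto_intros) (simp add: add.commute)
  then have "\<bar>freq i - dmass i n\<bar> \<le> (17/20)^n * 7"
    by (rule LIMSEQ_le_const2) (use dmass_Cauchy in blast)
  then show ?thesis by linarith
qed

lemma dmass_eq: "dmass i n = (\<integral>x. digit_ind i ((BR_map ^^ n) x) \<partial>unit_meas)"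
  using integral_transfer_pow[OF lipschitz_on_constant digit_ind_measurable digit_ind_bounds(3), of 1 i n]
  by (simp add: dmass_def dens_def mult.commute)

lemma dmass_bounds: "0 \<le> dmass i n" "dmass i n \<le> 1"
proof -
  have [measurable]: "(\<lambda>x. digit_ind i ((BR_map ^^ n) x)) \<in> borel_measurable unit_meas" by measurable
  show "0 \<le> dmass i n" unfolding dmass_eq using digit_ind_bounds by (intro Bochner_Integration.integral_nonneg) auto
  have "\<bar>dmass i n\<bar> \<le> 1" unfolding dmass_eq using digit_ind_bounds by (intro integral_U_le) auto
  then show "dmass i n \<le> 1" by simp
qed

lemma freq_bounds: "0 \<le> freq i" "freq i \<le> 1"
  using LIMSEQ_le_const[OF dmass_tendsto] LIMSEQ_le_const2[OF dmass_tendsto] dmass_bounds by blast+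

section \<open>Decay of correlations of the digits\<close>

text \<open>The first j steps turn Lebesgue measure into the density \<open>dens j\<close>. The
  indicator at time j and the step after it select one branch, leaving n steps for decorrelation;
  hence the gap \<open>Suc n\<close>. The constant 4 bounds 7/4 + 8/4, from the Lipschitz constant 7
  and the bound 8 of \<open>dens j\<close>.\<close>

lemma digit_pair_integral:
  assumes i: "i \<in> {1,2,3}"
  shows "\<bar>(\<integral>x. digit_ind i ((BR_map ^^ j) x) * digit_ind i ((BR_map ^^ (j + Suc n)) x) \<partial>unit_meas)
      - dmass i j * dmass i n\<bar> \<le> (17/20)^n * 4"
proof -
  let ?d = "digit_ind i"
  define v where "v = (\<lambda>x. ?d x * ?d ((BR_map ^^ n) (BR_map x)))"
  have [measurable]: "v \<in> borel_measurable unit_meas" unfolding v_def by measurable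
  have vb: "\<bar>v x\<bar> \<le> 1" for x by (simp add: v_def digit_ind_def)
  have dn: "\<bar>?d ((BR_map ^^ n) x)\<bar> \<le> 1" for x by (rule digit_ind_bounds)
  have "(BR_map ^^ (j + Suc n)) x = (BR_map ^^ n) (BR_map ((BR_map ^^ j) x))" for x
    by (metis add.commute comp_apply funpow_add funpow_Suc_right)
  then have "(\<integral>x. ?d ((BR_map ^^ j) x) * ?d ((BR_map ^^ (j + Suc n)) x) \<partial>unit_meas)
      = (\<integral>x. 1 * v ((BR_map ^^ j) x) \<partial>unit_meas)" by (simp add: v_def)
  also have "\<dots> = (\<integral>x. dens j x * v x \<partial>unit_meas)"
    unfolding dens_def using vb by (intro integral_transfer_pow[OF lipschitz_on_constant]) auto
  also have "\<dots> = (\<integral>x. ?d x * dens j x * ?d ((BR_map ^^ n) (BR_map x)) \<partial>unit_meas)"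
    by (simp add: v_def mult_ac)
  also have "\<dots> = (\<integral>x. btransfer i (dens j) x * ?d ((BR_map ^^ n) x) \<partial>unit_meas)"
    by (rule integral_digit_transfer[OF i dens_lipschitz _ dn]) measurable
  also have "\<dots> = (\<integral>x. ?d x * (transfer ^^ n) (btransfer i (dens j)) x \<partial>unit_meas)"
    using integral_transfer_pow[OF btransfer_lipschitz[OF i dens_lipschitz dens_bounded] digit_ind_measurable digit_ind_bounds(3), of j i n]
    by (simp add: mult.commute)
  finally have 1: "(\<integral>x. ?d ((BR_map ^^ j) x) * ?d ((BR_map ^^ (j + Suc n)) x) \<partial>unit_meas)
    = (\<integral>x. ?d x * (transfer ^^ n) (btransfer i (dens j)) x \<partial>unit_meas)" .
  have 2: "(\<integral>x. btransfer i (dens j) x \<partial>unit_meas) = dmass i j"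
    using integral_digit_transfer[OF i dens_lipschitz[of j], of "\<lambda>_. 1" 1] by (simp add: dmass_def)
  have "4-lipschitz_on {0..<1} (btransfer i (dens j))"
  proof (rule lipschitz_on_mono[OF btransfer_lipschitz[OF i dens_lipschitz dens_bounded]])
    have "8 / (4 * (real i * sqrt (real i))) \<le> 8 / (4 * (1 * 1))"
      using sqrt_digit_bounds(1)[OF i] i by (intro frac_le mult_left_mono mult_mono) auto
    moreover have "7 / (4 * real i) \<le> 7 / (4 * 1)" using i by (intro frac_le) auto
    ultimately show "7 / (4 * real i) + 8 / (4 * (real i * sqrt (real i))) \<le> 4" by simp
  qed auto
  from digit_transfer_pow_approx[OF this, of i n] show ?thesis unfolding 1 2 .
qed

text \<open>Lebesgue measure is not invariant, so \<open>freq i\<close> is not the exact mean of the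
  indicators. Besides the 4 from the pair integral, the two deviations of \<open>dmass\<close> from
  \<open>freq\<close> cost 7 each: 18 = 4 + 7 + 7.\<close>

lemma digit_correlation:
  assumes i: "i \<in> {1,2,3}"
  shows "\<bar>\<integral>x. (digit_ind i ((BR_map ^^ j) x) - freq i) * (digit_ind i ((BR_map ^^ (j + Suc n)) x) - freq i) \<partial>unit_meas\<bar>
    \<le> 18 * (17/20)^n"
proof -
  let ?a = "\<lambda>x. digit_ind i ((BR_map ^^ j) x)" and ?b = "\<lambda>x. digit_ind i ((BR_map ^^ (j + Suc n)) x)"
  let ?f = "freq i"
  have ia: "integrable unit_meas ?a" and ib: "integrable unit_meas ?b"
    by (rule integrable_U[where B=1]; simp add: digit_ind_bounds)+
  have iab: "integrable unit_meas (\<lambda>x. ?a x * ?b x)"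
    by (rule integrable_U[where B=1], measurable) (simp add: digit_ind_def)
  have "(?a x - ?f) * (?b x - ?f) = ?a x * ?b x - ?f * ?a x - ?f * ?b x + ?f * ?f" for x
    by (simp add: algebra_simps)
  then have "(\<integral>x. (?a x - ?f) * (?b x - ?f) \<partial>unit_meas)
      = (\<integral>x. ?a x * ?b x \<partial>unit_meas) - ?f * dmass i j - ?f * dmass i (j + Suc n) + ?f * ?f"
    using ia ib iab by (simp add: dmass_eq)
  also have "\<dots> = ((\<integral>x. ?a x * ?b x \<partial>unit_meas) - dmass i j * dmass i n)
      + dmass i j * (dmass i n - ?f) - ?f * (dmass i (j + Suc n) - ?f)"
    by (simp add: algebra_simps)
  finally have eq: "(\<integral>x. (?a x - ?f) * (?b x - ?f) \<partial>unit_meas) = \<dots>" .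
  have "\<bar>dmass i j * (dmass i n - ?f)\<bar> \<le> 1 * ((17/20)^n * 7)"
    unfolding abs_mult using dmass_bounds[of i j] dmass_freq by (intro mult_mono) auto
  moreover have "\<bar>?f * (dmass i (j + Suc n) - ?f)\<bar> \<le> 1 * ((17/20)^(j + Suc n) * 7)"
    unfolding abs_mult using freq_bounds[of i] dmass_freq[of i "j + Suc n"] by (intro mult_mono) auto
  moreover have "(17/20::real)^(j + Suc n) \<le> (17/20)^n" by (rule power_decreasing) auto
  ultimately show ?thesis unfolding eq using digit_pair_integral[OF i, of j n] by simp
qed


section \<open>A strong law of large numbers from exponentially decaying correlations\<close>

text \<open>Between consecutive squares s moves by at most 2 m, which is negligible against
  m^2.\<close>

lemma average_tendsto_0_of_squares:
  fixes s :: "nat \<Rightarrow> real"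
  assumes inc: "\<And>n. \<bar>s (Suc n) - s n\<bar> \<le> 1"
    and sq: "(\<lambda>m. s (m\<^sup>2) / real (m\<^sup>2)) \<longlonglongrightarrow> 0"
  shows "(\<lambda>n. s n / real n) \<longlonglongrightarrow> 0"
proof -
  have diff: "\<bar>s (n + k) - s n\<bar> \<le> real k" for n k
  proof (induction k)
    case (Suc k)
    then show ?case using inc[of "n + k"] by simp
  qed simp
  define t where "t = (\<lambda>m. \<bar>s (m\<^sup>2) / real (m\<^sup>2)\<bar> + 2 / real m)"
  have "t \<longlonglongrightarrow> \<bar>0\<bar> + 0"
    unfolding t_def by (intro tendsto_add tendsto_rabs sq lim_const_over_n)
  moreover have "filterlim floor_sqrt at_top sequentially"
    unfolding filterlim_at_top
  proof
    fix k
    show "\<forall>\<^sub>F n in sequentially. k \<le> floor_sqrt n"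
      using eventually_ge_at_top[of "k\<^sup>2"] by eventually_elim (simp add: le_floor_sqrt_iff)
  qed
  ultimately have lim: "(\<lambda>n. t (floor_sqrt n)) \<longlonglongrightarrow> 0"
    using filterlim_compose[of t "nhds 0"] by simp
  show ?thesis
  proof (rule Lim_null_comparison[OF _ lim])
    show "\<forall>\<^sub>F n in sequentially. norm (s n / real n) \<le> t (floor_sqrt n)"
      using eventually_gt_at_top[of 0]
    proof eventually_elim
      case (elim n)
      define m where "m = floor_sqrt n"
      have m: "m > 0" "m\<^sup>2 \<le> n" using elim by (auto simp: m_def)
      have "n < (Suc m)\<^sup>2" unfolding m_def by (rule Suc_floor_sqrt_power2_gt)
      then have n2: "n - m\<^sup>2 \<le> 2 * m" by (simp add: power2_eq_square)
      have "\<bar>s n - s (m\<^sup>2)\<bar> \<le> real (n - m\<^sup>2)" using diff[of "m\<^sup>2" "n - m\<^sup>2"] m by simp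
      also have "\<dots> \<le> 2 * real m" using n2 by linarith
      finally have "\<bar>s n\<bar> \<le> \<bar>s (m\<^sup>2)\<bar> + 2 * real m" by linarith
      then have "\<bar>s n\<bar> / real n \<le> (\<bar>s (m\<^sup>2)\<bar> + 2 * real m) / real (m\<^sup>2)"
        using m elim by (intro frac_le) (auto simp del: of_nat_power)
      also have "\<dots> = t m" using m by (simp add: t_def add_divide_distrib power2_eq_square)
      finally show ?case by (simp add: m_def)
    qed
  qed
qed

text \<open>One more summand adds its own square, at most 1, and twice its correlations with all
  earlier ones, whose geometric series is at most K / (1 - q).\<close>

lemma (in prob_space) second_moment_linear:
  fixes X :: "nat \<Rightarrow> 'a \<Rightarrow> real"
  assumes meas [measurable]: "\<And>n. X n \<in> borel_measurable M"
    and bnd: "\<And>n x. x \<in> space M \<Longrightarrow> \<bar>X n x\<bar> \<le> 1"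
    and corr: "\<And>j n. \<bar>\<integral>x. X j x * X (j + Suc n) x \<partial>M\<bar> \<le> K * q ^ n" and q: "0 \<le> q" "q < 1"
  shows "(\<integral>x. (\<Sum>j<n. X j x)\<^sup>2 \<partial>M) \<le> (1 + 2 * K / (1 - q)) * real n"
proof (induction n)
  case (Suc n)
  have K: "0 \<le> K" using corr[of 0 0] by simp
  have sb: "\<bar>\<Sum>j<n. X j x\<bar> \<le> real n" if "x \<in> space M" for x
    by (rule order_trans[OF sum_abs]) (use sum_bounded_above[of "{..<n}" "\<lambda>j. \<bar>X j x\<bar>" 1] bnd[OF that] in auto)
  have i1: "integrable M (\<lambda>x. (\<Sum>j<n. X j x)\<^sup>2)"
    by (rule integrable_const_bound[where B="(real n)\<^sup>2"]) (use sb in \<open>auto simp: abs_le_square_iff[symmetric]\<close>)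
  have i2: "integrable M (\<lambda>x. X j x * X n x)" for j
    by (rule integrable_const_bound[where B=1]) (use bnd in \<open>auto simp: abs_mult intro!: mult_le_one\<close>)
  have xx: "X n x * X n x \<le> 1" if "x \<in> space M" for x
    using bnd[OF that, of n] abs_le_square_iff[of "X n x" 1] by (simp add: power2_eq_square)
  have "(\<Sum>j<n. \<integral>x. X j x * X n x \<partial>M) \<le> (\<Sum>j<n. K * q ^ (n - Suc j))"
  proof (rule sum_mono)
    fix j assume "j \<in> {..<n}"
    then show "(\<integral>x. X j x * X n x \<partial>M) \<le> K * q ^ (n - Suc j)"
      using corr[of j "n - Suc j"] by simp
  qed
  also have "\<dots> = K * (\<Sum>j<n. q ^ j)"
    using sum.nat_diff_reindex[of "\<lambda>j. q ^ j" n] by (simp add: sum_distrib_left[symmetric])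
  also have "\<dots> \<le> K * (1 / (1 - q))"
  proof (rule mult_left_mono[OF _ K])
    show "(\<Sum>j<n. q ^ j) \<le> 1 / (1 - q)"
      using q sum_le_suminf[of "\<lambda>j. q ^ j" "{..<n}"] by (simp add: suminf_geometric summable_geometric)
  qed
  finally have cross: "(\<Sum>j<n. \<integral>x. X j x * X n x \<partial>M) \<le> K / (1 - q)" by simp
  have "(\<integral>x. (\<Sum>j<Suc n. X j x)\<^sup>2 \<partial>M)
      = (\<integral>x. (\<Sum>j<n. X j x)\<^sup>2 + 2 * (\<Sum>j<n. X j x * X n x) + X n x * X n x \<partial>M)"
    unfolding sum.lessThan_Suc power2_sum sum_distrib_right[symmetric]
    by (intro Bochner_Integration.integral_cong) (simp_all add: power2_eq_square)
  also have "\<dots> = (\<integral>x. (\<Sum>j<n. X j x)\<^sup>2 \<partial>M) + 2 * (\<Sum>j<n. \<integral>x. X j x * X n x \<partial>M) + (\<integral>x. X n x * X n x \<partial>M)"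
    using i1 i2 by simp
  finally have eq: "(\<integral>x. (\<Sum>j<Suc n. X j x)\<^sup>2 \<partial>M) = \<dots>" .
  have "(\<integral>x. X n x * X n x \<partial>M) \<le> (\<integral>x. 1 \<partial>M)"
    using i2 xx by (intro integral_mono) auto
  moreover have "(1 + 2 * K / (1 - q)) * real (Suc n) = (1 + 2 * K / (1 - q)) * real n + 1 + 2 * (K / (1 - q))"
    by (simp add: algebra_simps add_divide_distrib)
  ultimately show ?case using Suc.IH cross eq by (simp only: prob_space lebesgue_integral_const) simp
qed simp

text \<open>Along the squares the averages have second moment at most C / m^2, which is summable.
  The series of their squares thus has a finite integral, is finite almost everywhere, and its terms
  tend to 0 there.\<close>

lemma (in prob_space) AE_average_tendsto_0:
  fixes X :: "nat \<Rightarrow> 'a \<Rightarrow> real"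
  assumes meas [measurable]: "\<And>n. X n \<in> borel_measurable M"
    and bnd: "\<And>n x. x \<in> space M \<Longrightarrow> \<bar>X n x\<bar> \<le> 1"
    and corr: "\<And>j n. \<bar>\<integral>x. X j x * X (j + Suc n) x \<partial>M\<bar> \<le> K * q ^ n" and q: "0 \<le> q" "q < 1"
  shows "AE x in M. (\<lambda>n. (\<Sum>j<n. X j x) / real n) \<longlonglongrightarrow> 0"
proof -
  define S where "S = (\<lambda>n x. \<Sum>j<n. X j x)"
  have [measurable]: "S n \<in> borel_measurable M" for n unfolding S_def by measurable
  define C where "C = 1 + 2 * K / (1 - q)"
  have Sn: "(\<integral>x. (S n x)\<^sup>2 \<partial>M) \<le> C * real n" for n
    unfolding S_def C_def by (rule second_moment_linear[OF meas bnd corr q])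
  have "0 \<le> (\<integral>x. (S 1 x)\<^sup>2 \<partial>M)" by (rule Bochner_Integration.integral_nonneg) simp
  then have C: "0 \<le> C" using Sn[of 1] by linarith
  have sb: "\<bar>S n x\<bar> \<le> real n" if "x \<in> space M" for n x
    unfolding S_def
    by (rule order_trans[OF sum_abs]) (use sum_bounded_above[of "{..<n}" "\<lambda>j. \<bar>X j x\<bar>" 1] bnd[OF that] in auto)
  define Y where "Y = (\<lambda>m x. (S (m\<^sup>2) x / real (m\<^sup>2))\<^sup>2)"
  have [measurable]: "Y m \<in> borel_measurable M" for m unfolding Y_def by measurable
  have Y: "(\<integral>\<^sup>+x. ennreal (Y m x) \<partial>M) \<le> ennreal (C / real (m\<^sup>2))" for m
  proof -
    have "(S (m\<^sup>2) x)\<^sup>2 \<le> (real (m\<^sup>2))\<^sup>2" if "x \<in> space M" for x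
      using sb[OF that, of "m\<^sup>2"] abs_le_square_iff[of "S (m\<^sup>2) x" "real (m\<^sup>2)"] by simp
    then have "integrable M (\<lambda>x. (S (m\<^sup>2) x)\<^sup>2)"
      by (intro integrable_const_bound[where B="(real (m\<^sup>2))\<^sup>2"] AE_I2) auto
    then have "integrable M (Y m)" by (simp add: Y_def power_divide)
    then have "(\<integral>\<^sup>+x. ennreal (Y m x) \<partial>M) = ennreal (\<integral>x. Y m x \<partial>M)"
      by (intro nn_integral_eq_integral) (auto simp: Y_def)
    also have "(\<integral>x. Y m x \<partial>M) \<le> C / real (m\<^sup>2)"
    \<comment> \<open>For m = 0 both sides are 0, since division by 0 gives 0.\<close>
    proof (cases "m = 0")
      case False
      then show ?thesis using Sn[of "m\<^sup>2"]
        by (simp add: Y_def power_divide field_simps power2_eq_square)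
    qed (simp add: Y_def)
    finally show ?thesis by (simp add: ennreal_leI)
  qed
  have sm: "summable (\<lambda>m. C / real (m\<^sup>2))"
    using summable_mult[OF inverse_power_summable[of 2, where 'a=real], of C] by (simp add: divide_inverse)
  have "(\<integral>\<^sup>+x. (\<Sum>m. ennreal (Y m x)) \<partial>M) = (\<Sum>m. \<integral>\<^sup>+x. ennreal (Y m x) \<partial>M)"
    by (rule nn_integral_suminf) measurable
  also have "\<dots> \<le> (\<Sum>m. ennreal (C / real (m\<^sup>2)))"
    by (intro suminf_le Y) auto
  also have "\<dots> = ennreal (\<Sum>m. C / real (m\<^sup>2))"
    using sm C by (intro suminf_ennreal_eq summable_sums) auto
  finally have "(\<integral>\<^sup>+x. (\<Sum>m. ennreal (Y m x)) \<partial>M) \<noteq> \<infinity>" by (auto simp: top_unique)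
  then have "AE x in M. (\<Sum>m. ennreal (Y m x)) \<noteq> \<infinity>"
    by (intro nn_integral_PInf_AE) measurable
  then show ?thesis
  proof (rule AE_mp, intro AE_I2 impI)
    fix x assume x: "x \<in> space M" and fin: "(\<Sum>m. ennreal (Y m x)) \<noteq> \<infinity>"
    have "summable (\<lambda>m. Y m x)"
      using fin by (intro summable_suminf_not_top) (auto simp: Y_def)
    then have "(\<lambda>m. sqrt (Y m x)) \<longlonglongrightarrow> sqrt 0"
      by (intro tendsto_real_sqrt summable_LIMSEQ_zero)
    then have "(\<lambda>m. S (m\<^sup>2) x / real (m\<^sup>2)) \<longlonglongrightarrow> 0"
      by (subst tendsto_rabs_zero_iff[symmetric]) (simp add: Y_def)
    then have "(\<lambda>n. S n x / real n) \<longlonglongrightarrow> 0"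
      by (intro average_tendsto_0_of_squares[of "\<lambda>n. S n x"]) (use bnd[OF x] in \<open>auto simp: S_def\<close>)
    then show "(\<lambda>n. (\<Sum>j<n. X j x) / real n) \<longlonglongrightarrow> 0" by (simp add: S_def)
  qed
qed

lemma card_BR_digit:
  "real (card {k \<in> {1..n}. BR_digit k x = i}) = (\<Sum>j<n. digit_ind i ((BR_map ^^ j) x))"
proof -
  have "{k \<in> {1..n}. BR_digit k x = i} = Suc ` {j \<in> {..<n}. BR_index ((BR_map ^^ j) x) = i}"
  proof (intro equalityI subsetI)
    fix k assume "k \<in> {k \<in> {1..n}. BR_digit k x = i}"
    then show "k \<in> Suc ` {j \<in> {..<n}. BR_index ((BR_map ^^ j) x) = i}"
      by (intro image_eqI[of _ _ "k - 1"]) (auto simp: BR_digit_def)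
  qed (auto simp: BR_digit_def)
  then have "card {k \<in> {1..n}. BR_digit k x = i} = card {j \<in> {..<n}. BR_index ((BR_map ^^ j) x) = i}"
    by (simp add: card_image)
  also have "real \<dots> = (\<Sum>j\<in>{j \<in> {..<n}. BR_index ((BR_map ^^ j) x) = i}. 1)" by simp
  also have "\<dots> = (\<Sum>j<n. digit_ind i ((BR_map ^^ j) x))"
    unfolding digit_ind_def by (subst sum.inter_filter) auto
  finally show ?thesis .
qed

lemma AE_digit_frequency:
  assumes i: "i \<in> {1,2,3}"
  shows "AE x in unit_meas. (\<lambda>n. real (card {k \<in> {1..n}. BR_digit k x = i}) / real n) \<longlonglongrightarrow> freq i"
proof -
  define X where "X = (\<lambda>n x. digit_ind i ((BR_map ^^ n) x) - freq i)"
  have "AE x in unit_meas. (\<lambda>n. (\<Sum>j<n. X j x) / real n) \<longlonglongrightarrow> 0"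
  proof (rule U.AE_average_tendsto_0)
    show "X n \<in> borel_measurable unit_meas" for n unfolding X_def by measurable
    show "\<bar>X n x\<bar> \<le> 1" for n x
      using freq_bounds[of i] digit_ind_bounds[of i "(BR_map ^^ n) x"] by (simp add: X_def abs_le_iff)
    show "\<bar>\<integral>x. X j x * X (j + Suc n) x \<partial>unit_meas\<bar> \<le> 18 * (17/20) ^ n" for j n
      unfolding X_def by (rule digit_correlation[OF i])
  qed auto
  then show ?thesis
  proof eventually_elim
    case (elim x)
    have "(\<lambda>n. (\<Sum>j<n. X j x) / real n + freq i) \<longlonglongrightarrow> 0 + freq i"
      by (intro tendsto_add elim tendsto_const)
    \<comment> \<open>The identity needs n > 0: at n = 0 both quotients are 0 and
      \<open>freq i\<close> would be left over.\<close>
    moreover have "\<forall>\<^sub>F n in sequentially. (\<Sum>j<n. X j x) / real n + freq i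
        = real (card {k \<in> {1..n}. BR_digit k x = i}) / real n"
      using eventually_gt_at_top[of 0]
      unfolding card_BR_digit by eventually_elim (simp add: X_def sum_subtractf field_simps)
    ultimately show ?case using tendsto_cong by fastforce
  qed
qed

section \<open>Frequencies from an approximate fixed point\<close>

text \<open>Telescoping p against its iterates: each difference is an iterate of the mean-zero
  residual, so the total is at most D / (1 - 17/20) = 20 D / 3, while the integral of the n-th
  iterate over I_i tends to the mean times \<open>freq i\<close>. The constant C enters only this
  limit, not the bound.\<close>

lemma digit_freq_approx:
  assumes p: "C-lipschitz_on {0..<1} p" and r: "D-lipschitz_on {0..<1} (\<lambda>x. p x - transfer p x)"
  shows "\<bar>(\<integral>x. digit_ind i x * p x \<partial>unit_meas) - (\<integral>x. p x \<partial>unit_meas) * freq i\<bar> \<le> D * 20 / 3"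
proof -
  let ?I = "\<lambda>u. \<integral>x. digit_ind i x * u x \<partial>unit_meas"
  let ?m = "\<integral>x. p x \<partial>unit_meas"
  define r where "r = (\<lambda>x. p x - 1 * transfer p x)"
  have rl: "D-lipschitz_on {0..<1} r" using assms(2) by (simp add: r_def)
  obtain E where E: "E-lipschitz_on {0..<1} (transfer p)" using transfer_lipschitz_ex[OF p] by blast
  have D: "0 \<le> D" using lipschitz_on_nonneg[OF rl] .
  have r0: "(\<integral>x. r x \<partial>unit_meas) = 0"
    using integral_transfer_pow_1[OF p, of 1] lipschitz_integrable_U[OF p] lipschitz_integrable_U[OF E] by (simp add: r_def)
  have step: "\<bar>?I ((transfer ^^ k) p) - ?I ((transfer ^^ Suc k) p)\<bar> \<le> (17/20)^k * D" for k
  proof -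
    obtain A where A: "A-lipschitz_on {0..<1} ((transfer ^^ k) p)" using transfer_pow_lipschitz_ex[OF p] by blast
    obtain B where B: "B-lipschitz_on {0..<1} ((transfer ^^ Suc k) p)" using transfer_pow_lipschitz_ex[OF p] by blast
    have "(transfer ^^ k) r = (\<lambda>x. (transfer ^^ k) p x - (transfer ^^ Suc k) p x)"
      unfolding r_def transfer_pow_lincomb by (simp add: funpow_swap1)
    then have "?I ((transfer ^^ k) r) = ?I ((transfer ^^ k) p) - ?I ((transfer ^^ Suc k) p)"
      using integrable_digit_mult[OF A] integrable_digit_mult[OF B] by (simp add: right_diff_distrib)
    then show ?thesis using digit_transfer_pow_approx[OF rl, of i k] r0 by simp
  qed
  have tel: "\<bar>?I p - ?I ((transfer ^^ n) p)\<bar> \<le> D * 20 / 3" for n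
  proof -
    have "?I p - ?I ((transfer ^^ n) p) = (\<Sum>k<n. ?I ((transfer ^^ k) p) - ?I ((transfer ^^ Suc k) p))"
      by (subst sum_lessThan_telescope') simp
    also have "\<bar>\<dots>\<bar> \<le> (\<Sum>k<n. (17/20)^k * D)"
      by (rule order_trans[OF sum_abs sum_mono]) (rule step)
    also have "\<dots> \<le> 20 / 3 * D"
      unfolding sum_distrib_right[symmetric]
      using sum_le_suminf[of "\<lambda>j. (17/20::real) ^ j" "{..<n}"] D
      by (intro mult_right_mono) (simp_all add: suminf_geometric summable_geometric)
    finally show ?thesis by (simp add: mult.commute)
  qed
  have lim: "(\<lambda>n. ?I ((transfer ^^ n) p)) \<longlonglongrightarrow> ?m * freq i"
  proof (rule Lim_transform)
    show "(\<lambda>n. ?m * dmass i n) \<longlonglongrightarrow> ?m * freq i"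
      by (intro tendsto_mult_left dmass_tendsto)
    have "(\<lambda>n. (17/20::real)^n * C) \<longlonglongrightarrow> 0"
      by (intro tendsto_mult_left_zero LIMSEQ_power_zero) simp
    then show "(\<lambda>n. ?I ((transfer ^^ n) p) - ?m * dmass i n) \<longlonglongrightarrow> 0"
      by (rule Lim_null_comparison[rotated])
         (use digit_transfer_pow_approx[OF p] in auto)
  qed
  have "(\<lambda>n. \<bar>?I p - ?I ((transfer ^^ n) p)\<bar>) \<longlonglongrightarrow> \<bar>?I p - ?m * freq i\<bar>"
    by (intro tendsto_intros lim)
  then show ?thesis by (rule LIMSEQ_le_const2) (use tel in blast)
qed


section \<open>Integer polynomials with rounded composition\<close>

abbreviation pval :: "int list \<Rightarrow> real \<Rightarrow> real" where
  "pval xs v \<equiv> horner_sum of_int v xs"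

definition shr :: "nat \<Rightarrow> int \<Rightarrow> int" where "shr d x = x div 2 ^ d"

text \<open>The condition -2^d <= x < 2^d, in a form that on bit strings costs only d dropped bits
  and a look at the sign.\<close>

definition fits :: "nat \<Rightarrow> int \<Rightarrow> bool" where "fits d x \<longleftrightarrow> shr d x \<in> {0, -1}"

text \<open>Rounding down sends small negative numbers to -1, never to 0, so a negligible tail
  consists of both values; cutting both keeps the lists short.\<close>

definition scons :: "int \<Rightarrow> int list \<Rightarrow> int list" where
  "scons x xs = (if xs = [] \<and> x \<in> {0, -1} then [] else x # xs)"

text \<open>One rounded Horner step: coefficient lists start with the constant term, \<open>xs\<close> is multiplied by
  \<open>(a + b * v + c * v\<^sup>2) / 2 ^ d\<close>, and \<open>p\<close>, \<open>q\<close> are the two coefficients preceding \<open>xs\<close>. Since \<open>scons\<close>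
  drops trailing entries \<open>0\<close> and \<open>-1\<close>, each coefficient of the result is off by at most 1.\<close>

fun quad_step :: "int \<Rightarrow> int \<Rightarrow> int \<Rightarrow> nat \<Rightarrow> int \<Rightarrow> int \<Rightarrow> int list \<Rightarrow> int list" where
  "quad_step a b c d p q [] = scons (shr d (b * p + c * q)) (scons (shr d (c * p)) [])"
| "quad_step a b c d p q (x # xs) = scons (shr d (a * x + b * p + c * q)) (quad_step a b c d x p xs)"

fun add_const :: "int \<Rightarrow> int list \<Rightarrow> int list" where
  "add_const c [] = [c]"
| "add_const c (x # xs) = (c + x) # xs"

text \<open>Horner's rule for substituting (a + b * v + c * v^2) / 2^d into a polynomial. Rounding
  after each step avoids accumulating powers of the denominator.\<close>

fun quad_comp :: "int \<Rightarrow> int \<Rightarrow> int \<Rightarrow> nat \<Rightarrow> int list \<Rightarrow> int list" where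
  "quad_comp a b c d [] = []"
| "quad_comp a b c d (y # ys) = add_const y (quad_step a b c d 0 0 (quad_comp a b c d ys))"

fun padd :: "int list \<Rightarrow> int list \<Rightarrow> int list" where
  "padd [] ys = ys"
| "padd (x # xs) [] = x # xs"
| "padd (x # xs) (y # ys) = (x + y) # padd xs ys"

text \<open>All coefficients of \<open>(a + b * v) * xs + c * ys\<close> lie in \<open>[-2 ^ g, 2 ^ g)\<close>.\<close>

fun residual_fits :: "nat \<Rightarrow> int \<Rightarrow> int \<Rightarrow> int \<Rightarrow> int \<Rightarrow> int list \<Rightarrow> int list \<Rightarrow> bool" where
  "residual_fits g a b c p [] [] = fits g (b * p)"
| "residual_fits g a b c p (x # xs) [] = (fits g (a * x + b * p) \<and> residual_fits g a b c x xs [])"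
| "residual_fits g a b c p [] (y # ys) = (fits g (b * p + c * y) \<and> residual_fits g a b c 0 [] ys)"
| "residual_fits g a b c p (x # xs) (y # ys) = (fits g (a * x + b * p + c * y) \<and> residual_fits g a b c x xs ys)"

lemma pval_padd: "pval (padd xs ys) v = pval xs v + pval ys v"
  by (induction xs ys rule: padd.induct) (simp_all add: algebra_simps)

lemma pval_add_const: "pval (add_const c xs) v = of_int c + pval xs v"
  by (cases xs) simp_all

lemma length_scons: "length (scons x xs) \<le> Suc (length xs)"
  by (simp add: scons_def)

lemma length_quad_step: "length (quad_step a b c d p q xs) \<le> length xs + 2"
proof (induction xs arbitrary: p q)
  case Nil
  show ?case using length_scons[of "shr d (b * p + c * q)" "scons (shr d (c * p)) []"] length_scons[of "shr d (c * p)" "[]"] by simp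
next
  case (Cons x xs)
  show ?case using order_trans[OF length_scons Suc_le_mono[THEN iffD2, OF Cons.IH[of x p]]] by simp
qed

lemma length_quad_comp: "length (quad_comp a b c d ys) \<le> 2 * length ys"
proof (induction ys)
  case (Cons y ys)
  have *: "length (add_const y zs) \<le> k" if "length zs \<le> k" "1 \<le> k" for zs k
    using that by (cases zs) auto
  show ?case using Cons length_quad_step[of a b c d 0 0 "quad_comp a b c d ys"]
    by (simp, intro *) linarith+
qed simp

lemma shr_error: "0 \<le> of_int A / 2 ^ d - real_of_int (shr d A)" "of_int A / 2 ^ d - real_of_int (shr d A) < 1"
proof -
  have "real_of_int (shr d A) = of_int \<lfloor>real_of_int A / real_of_int (2 ^ d)\<rfloor>"
    unfolding shr_def floor_divide_of_int_eq ..
  then show "0 \<le> of_int A / 2 ^ d - real_of_int (shr d A)" "of_int A / 2 ^ d - real_of_int (shr d A) < 1"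
    by (simp_all, linarith)
qed

lemma fits_bound: "fits g x \<Longrightarrow> \<bar>real_of_int x\<bar> \<le> 2 ^ g"
  using shr_error[of x g] by (auto simp: fits_def field_simps)

text \<open>The error e is one number valid for all v. Where an entry is cut, its rounded value is 0
  or -1, so the exact quotient is itself at most 1 in absolute value.\<close>

lemma scons_shr_error:
  "\<exists>e. \<bar>e\<bar> \<le> 1 \<and> (\<forall>v. pval (scons (shr d A) xs) v = of_int A / 2 ^ d + v * pval xs v + e)"
proof (cases "xs = [] \<and> shr d A \<in> {0, -1}")
  case True
  then have "real_of_int (shr d A) = 0 \<or> real_of_int (shr d A) = -1" by auto
  then have "\<bar>- (real_of_int A / 2 ^ d)\<bar> \<le> 1" using shr_error[of A d] by linarith
  moreover have "pval (scons (shr d A) xs) v = of_int A / 2 ^ d + v * pval xs v + - (of_int A / 2 ^ d)" for v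
    using True by (auto simp: scons_def)
  ultimately show ?thesis by blast
next
  case False
  then have "scons (shr d A) xs = shr d A # xs" by (auto simp: scons_def)
  then have "pval (scons (shr d A) xs) v = of_int A / 2 ^ d + v * pval xs v + (of_int (shr d A) - of_int A / 2 ^ d)" for v
    by simp
  moreover have "\<bar>real_of_int (shr d A) - of_int A / 2 ^ d\<bar> \<le> 1" using shr_error[of A d] by linarith
  ultimately show ?thesis by blast
qed

text \<open>The rounding error is exhibited as a polynomial with coefficients at most 1, because a
  pointwise bound would say nothing about its slope.\<close>

lemma quad_step_error:
  "\<exists>es. length es \<le> length xs + 2 \<and> (\<forall>e\<in>set es. \<bar>e\<bar> \<le> (1::real)) \<and>
     (\<forall>v. pval (quad_step a b c d p q xs) v =
        (of_int a * pval xs v + of_int b * (of_int p + v * pval xs v)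
          + of_int c * (of_int q + v * (of_int p + v * pval xs v))) / 2 ^ d + horner_sum (\<lambda>a. a) v es)"
proof (induction xs arbitrary: p q)
  case Nil
  obtain e1 where e1: "\<bar>e1\<bar> \<le> 1" "\<And>v. pval (scons (shr d (c * p)) []) v = of_int (c * p) / 2 ^ d + v * pval [] v + e1"
    using scons_shr_error by blast
  obtain e0 where e0: "\<bar>e0\<bar> \<le> 1" "\<And>v. pval (scons (shr d (b * p + c * q)) (scons (shr d (c * p)) [])) v
      = of_int (b * p + c * q) / 2 ^ d + v * pval (scons (shr d (c * p)) []) v + e0"
    using scons_shr_error by blast
  show ?case
    by (rule exI[of _ "[e0, e1]"]) (simp add: e0 e1 add_divide_distrib algebra_simps)
next
  case (Cons x xs)
  obtain es where es: "length es \<le> length xs + 2" "\<forall>e\<in>set es. \<bar>e\<bar> \<le> (1::real)"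
     "\<And>v. pval (quad_step a b c d x p xs) v =
        (of_int a * pval xs v + of_int b * (of_int x + v * pval xs v)
          + of_int c * (of_int p + v * (of_int x + v * pval xs v))) / 2 ^ d + horner_sum (\<lambda>a. a) v es"
    using Cons.IH[of x p] by blast
  obtain e where e: "\<bar>e\<bar> \<le> 1" "\<And>v. pval (scons (shr d (a * x + b * p + c * q)) (quad_step a b c d x p xs)) v
      = of_int (a * x + b * p + c * q) / 2 ^ d + v * pval (quad_step a b c d x p xs) v + e"
    using scons_shr_error by blast
  show ?case
  proof (intro exI[of _ "e # es"] conjI allI)
    fix v
    show "pval (quad_step a b c d p q (x # xs)) v =
        (of_int a * pval (x # xs) v + of_int b * (of_int p + v * pval (x # xs) v)
          + of_int c * (of_int q + v * (of_int p + v * pval (x # xs) v))) / 2 ^ d + horner_sum (\<lambda>a. a) v (e # es)"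
      unfolding quad_step.simps e(2) es(3) by (simp add: add_divide_distrib algebra_simps)
  qed (use es(1,2) e(1) in auto)
qed

lemma residual_fits_imp:
  "residual_fits g a b c p xs ys \<Longrightarrow>
   \<exists>rs. length rs \<le> Suc (max (length xs) (length ys)) \<and> (\<forall>r\<in>set rs. \<bar>r\<bar> \<le> (2::real) ^ g) \<and>
     (\<forall>v. of_int a * pval xs v + of_int b * (of_int p + v * pval xs v) + of_int c * pval ys v = horner_sum (\<lambda>a. a) v rs)"
proof (induction g a b c p xs ys rule: residual_fits.induct)
  case (1 g a b c p)
  then show ?case using fits_bound[of g "b * p"] by (intro exI[of _ "[of_int (b * p)]"]) simp
next
  case (2 g a b c p x xs)
  then obtain rs where rs: "length rs \<le> Suc (max (length xs) (length ([] :: int list)))" "\<forall>r\<in>set rs. \<bar>r\<bar> \<le> (2::real) ^ g"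
     "\<And>v. of_int a * pval xs v + of_int b * (of_int x + v * pval xs v) + of_int c * pval [] v = horner_sum (\<lambda>a. a) v rs"
    unfolding residual_fits.simps by blast
  have "\<bar>real_of_int (a * x + b * p)\<bar> \<le> 2 ^ g" using 2 by (intro fits_bound) simp
  with rs(1,2) show ?case
    by (intro exI[of _ "of_int (a * x + b * p) # rs"]) (simp add: algebra_simps flip: rs(3))
next
  case (3 g a b c p y ys)
  then obtain rs where rs: "length rs \<le> Suc (max (length ([] :: int list)) (length ys))" "\<forall>r\<in>set rs. \<bar>r\<bar> \<le> (2::real) ^ g"
     "\<And>v. of_int a * pval [] v + of_int b * (of_int 0 + v * pval [] v) + of_int c * pval ys v = horner_sum (\<lambda>a. a) v rs"
    unfolding residual_fits.simps by blast
  have "\<bar>real_of_int (b * p + c * y)\<bar> \<le> 2 ^ g" using 3 by (intro fits_bound) simp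
  with rs(1,2) show ?case
    by (intro exI[of _ "of_int (b * p + c * y) # rs"]) (simp add: algebra_simps flip: rs(3))
next
  case (4 g a b c p x xs y ys)
  then obtain rs where rs: "length rs \<le> Suc (max (length xs) (length ys))" "\<forall>r\<in>set rs. \<bar>r\<bar> \<le> (2::real) ^ g"
     "\<And>v. of_int a * pval xs v + of_int b * (of_int x + v * pval xs v) + of_int c * pval ys v = horner_sum (\<lambda>a. a) v rs"
    unfolding residual_fits.simps by blast
  have "\<bar>real_of_int (a * x + b * p + c * y)\<bar> \<le> 2 ^ g" using 4 by (intro fits_bound) simp
  with rs(1,2) show ?case
    by (intro exI[of _ "of_int (a * x + b * p + c * y) # rs"]) (simp add: algebra_simps flip: rs(3))
qed

section \<open>Propagation of sup and Lipschitz bounds\<close>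

text \<open>The slope of a product involves the size of its factors, so the two bounds are carried
  together.\<close>

definition lip_bdd :: "real \<Rightarrow> real \<Rightarrow> (real \<Rightarrow> real) \<Rightarrow> bool" where
  "lip_bdd B L f \<longleftrightarrow> (\<forall>x\<in>{0..<1}. \<bar>f x\<bar> \<le> B) \<and> L-lipschitz_on {0..<1} f"

lemma lip_bdd_nonneg: "lip_bdd B L f \<Longrightarrow> 0 \<le> B \<and> 0 \<le> L"
proof -
  assume "lip_bdd B L f"
  then have "\<bar>f 0\<bar> \<le> B" "0 \<le> L" by (auto simp: lip_bdd_def lipschitz_on_nonneg)
  then show ?thesis by linarith
qed

lemma lip_bdd_const: "\<bar>c\<bar> \<le> B \<Longrightarrow> lip_bdd B 0 (\<lambda>_. c)"
  by (simp add: lip_bdd_def lipschitz_on_constant)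

lemma lip_bdd_mono: "lip_bdd B L f \<Longrightarrow> B \<le> B' \<Longrightarrow> L \<le> L' \<Longrightarrow> lip_bdd B' L' f"
  unfolding lip_bdd_def by (auto intro: lipschitz_on_mono order_trans)

lemma lip_bdd_add: "lip_bdd B L f \<Longrightarrow> lip_bdd B' L' g \<Longrightarrow> lip_bdd (B + B') (L + L') (\<lambda>x. f x + g x)"
  unfolding lip_bdd_def by (auto intro!: lipschitz_on_add order_trans[OF abs_triangle_ineq] add_mono)

lemma lip_bdd_diff: "lip_bdd B L f \<Longrightarrow> lip_bdd B' L' g \<Longrightarrow> lip_bdd (B + B') (L + L') (\<lambda>x. f x - g x)"
  unfolding lip_bdd_def by (auto intro!: lipschitz_on_diff order_trans[OF abs_triangle_ineq4] add_mono)

lemma lip_bdd_mult: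
  assumes f: "lip_bdd B L f" and g: "lip_bdd B' L' g"
  shows "lip_bdd (B * B') (B * L' + L * B') (\<lambda>x. f x * g x)"
  unfolding lip_bdd_def
proof (intro conjI ballI lipschitz_onI)
  note nn = lip_bdd_nonneg[OF f] lip_bdd_nonneg[OF g]
  have fb: "\<bar>f x\<bar> \<le> B" "\<bar>g x\<bar> \<le> B'" if "x \<in> {0..<1}" for x
    using f g that by (auto simp: lip_bdd_def)
  show "\<bar>f x * g x\<bar> \<le> B * B'" if "x \<in> {0..<1}" for x
    unfolding abs_mult using fb[OF that] nn by (intro mult_mono) auto
  show "0 \<le> B * L' + L * B'" using nn by simp
  fix x y :: real assume xy: "x \<in> {0..<1}" "y \<in> {0..<1}"
  have "\<bar>f x - f y\<bar> \<le> L * \<bar>x - y\<bar>" "\<bar>g x - g y\<bar> \<le> L' * \<bar>x - y\<bar>"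
    using f g lipschitz_onD[OF _ xy, of L f] lipschitz_onD[OF _ xy, of L' g]
    by (simp_all add: lip_bdd_def dist_real_def)
  then have "\<bar>f x\<bar> * \<bar>g x - g y\<bar> \<le> B * (L' * \<bar>x - y\<bar>)" "\<bar>f x - f y\<bar> * \<bar>g y\<bar> \<le> (L * \<bar>x - y\<bar>) * B'"
    using fb[OF xy(1)] fb[OF xy(2)] nn by (intro mult_mono; simp)+
  then have "\<bar>f x * (g x - g y)\<bar> + \<bar>(f x - f y) * g y\<bar> \<le> (B * L' + L * B') * \<bar>x - y\<bar>"
    unfolding abs_mult distrib_right by (simp add: mult_ac)
  moreover have "f x * g x - f y * g y = f x * (g x - g y) + (f x - f y) * g y" by (simp add: algebra_simps)
  ultimately show "dist (f x * g x) (f y * g y) \<le> (B * L' + L * B') * dist x y"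
    unfolding dist_real_def by linarith
qed

lemma lip_bdd_cong: "lip_bdd B L f \<Longrightarrow> (\<And>x. x \<in> {0..<1} \<Longrightarrow> f x = g x) \<Longrightarrow> lip_bdd B L g"
  unfolding lip_bdd_def by (metis lipschitz_on_cong)

lemma lip_bdd_horner:
  assumes V: "lip_bdd 1 \<kappa> V" and "\<forall>r\<in>set rs. \<bar>r\<bar> \<le> m" "0 \<le> m"
  shows "lip_bdd (m * real (length rs)) (\<kappa> * m * (real (length rs))\<^sup>2) (\<lambda>x. horner_sum (\<lambda>a. a) (V x) rs)"
  using assms(2)
proof (induction rs)
  case (Cons r rs)
  let ?l = "real (length rs)"
  have "0 \<le> \<kappa>" using lip_bdd_nonneg[OF V] by simp
  have "lip_bdd (m + 1 * (m * ?l)) (0 + (1 * (\<kappa> * m * ?l\<^sup>2) + \<kappa> * (m * ?l))) (\<lambda>x. r + V x * horner_sum (\<lambda>a. a) (V x) rs)"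
    using Cons by (intro lip_bdd_add lip_bdd_const lip_bdd_mult V) auto
  then have "lip_bdd (m * real (length (r # rs))) (\<kappa> * m * (real (length (r # rs)))\<^sup>2) (\<lambda>x. r + V x * horner_sum (\<lambda>a. a) (V x) rs)"
  proof (rule lip_bdd_mono)
    have "0 \<le> \<kappa> * m * (?l + 1)" using \<open>0 \<le> \<kappa>\<close> \<open>0 \<le> m\<close> by simp
    then show "0 + (1 * (\<kappa> * m * ?l\<^sup>2) + \<kappa> * (m * ?l)) \<le> \<kappa> * m * (real (length (r # rs)))\<^sup>2"
      by (simp add: power2_eq_square algebra_simps)
  qed (simp add: algebra_simps)
  then show ?case by simp
qed (use lip_bdd_const[of 0 0] in simp)

text \<open>The error obeys E' = z * E + H with H the rounding polynomial of the step. As z is at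
  most 1 in absolute value, errors add up without being amplified. Per step, H costs 2 N in size and
  4 * (2 N)^2 = 16 N^2 in slope, and the slope 2 of z acting on E costs at most 4 N^2 more.\<close>

lemma quad_comp_error:
  assumes V: "lip_bdd 1 4 V" and z: "lip_bdd 1 2 z"
    and zV: "\<And>x. x \<in> {0..<1} \<Longrightarrow> z x = (of_int a + of_int b * V x + of_int c * (V x)\<^sup>2) / 2 ^ d"
    and "length ys \<le> N"
  shows "\<exists>E. lip_bdd (real (length ys) * (2 * real N)) (real (length ys) * (20 * (real N)\<^sup>2)) E \<and>
    (\<forall>x\<in>{0..<1}. pval (quad_comp a b c d ys) (V x) = pval ys (z x) + E x)"
  using assms(4)
proof (induction ys)
  case Nil
  show ?case by (rule exI[of _ "\<lambda>_. 0"]) (use lip_bdd_const[of 0 0] in simp)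
next
  case (Cons y ys)
  let ?l = "real (length ys)" and ?b = "quad_comp a b c d ys"
  obtain E where E: "lip_bdd (?l * (2 * real N)) (?l * (20 * (real N)\<^sup>2)) E"
    "\<And>x. x \<in> {0..<1} \<Longrightarrow> pval ?b (V x) = pval ys (z x) + E x" using Cons by auto
  obtain es where es: "length es \<le> length ?b + 2" "\<forall>e\<in>set es. \<bar>e\<bar> \<le> (1::real)"
    "\<And>v. pval (quad_step a b c d 0 0 ?b) v = (of_int a * pval ?b v + of_int b * (v * pval ?b v)
          + of_int c * (v * (v * pval ?b v))) / 2 ^ d + horner_sum (\<lambda>a. a) v es"
    using quad_step_error[of ?b a b c d 0 0] by auto
  have len: "real (length es) \<le> 2 * real N"
    using es(1) length_quad_comp[of a b c d ys] Cons.prems by simp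
  have "lip_bdd (1 * real (length es)) (4 * 1 * (real (length es))\<^sup>2) (\<lambda>x. horner_sum (\<lambda>a. a) (V x) es)"
    using es(2) by (intro lip_bdd_horner[OF V]) auto
  then have H: "lip_bdd (2 * real N) (16 * (real N)\<^sup>2) (\<lambda>x. horner_sum (\<lambda>a. a) (V x) es)"
    by (rule lip_bdd_mono) (use len power_mono[OF len, of 2] in auto)
  have "lip_bdd (1 * (?l * (2 * real N)) + 2 * real N)
      (1 * (?l * (20 * (real N)\<^sup>2)) + 2 * (?l * (2 * real N)) + 16 * (real N)\<^sup>2) (\<lambda>x. z x * E x + horner_sum (\<lambda>a. a) (V x) es)"
    by (intro lip_bdd_add lip_bdd_mult z E(1) H)
  then have "lip_bdd (real (length (y # ys)) * (2 * real N)) (real (length (y # ys)) * (20 * (real N)\<^sup>2))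
     (\<lambda>x. z x * E x + horner_sum (\<lambda>a. a) (V x) es)"
  proof (rule lip_bdd_mono)
    have "?l * real N \<le> real N * real N" using Cons.prems by (intro mult_right_mono) auto
    then show "1 * (?l * (20 * (real N)\<^sup>2)) + 2 * (?l * (2 * real N)) + 16 * (real N)\<^sup>2 \<le> real (length (y # ys)) * (20 * (real N)\<^sup>2)"
      by (simp add: power2_eq_square algebra_simps)
  qed (simp add: algebra_simps)
  moreover have "pval (quad_comp a b c d (y # ys)) (V x) = pval (y # ys) (z x) + (z x * E x + horner_sum (\<lambda>a. a) (V x) es)"
    if x: "x \<in> {0..<1}" for x
  proof -
    have "pval (quad_comp a b c d (y # ys)) (V x) = of_int y + (z x * pval ?b (V x) + horner_sum (\<lambda>a. a) (V x) es)"
      unfolding quad_comp.simps pval_add_const es(3) zV[OF x] by (simp add: power2_eq_square field_simps)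
    then show ?thesis unfolding E(2)[OF x] by (simp add: algebra_simps)
  qed
  ultimately show ?case by blast
qed


lemma lip_bdd_centered: "lip_bdd 1 2 (\<lambda>x. 2 * x - 1)"
  unfolding lip_bdd_def
proof (intro conjI ballI lipschitz_onI)
  show "dist (2 * x - 1) (2 * y - 1) \<le> 2 * dist x y" for x y :: real
    unfolding dist_real_def by (simp add: abs_if)
qed (auto simp: abs_le_iff)

text \<open>With \<open>s = sqrt (x + i)\<close>, put \<open>s = (n0 + n1 * V) / (2 * h)\<close>, where \<open>\<bar>V\<bar> \<le> 1\<close>. Then
  \<open>2 * x - 1 = (a + b * V + c * V\<^sup>2) / 2 ^ d\<close> and \<open>2 * (s - 1) - 1 = (\<alpha> + \<beta> * V) / 2 ^ e\<close>.\<close>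

lemma residual_lip_bdd:
  fixes n0 n1 h a b c \<alpha> \<beta> :: int
  assumes i: "i \<in> {1,2,3}" and len: "length P \<le> 150" "length Q \<le> 150"
    and h: "16 \<le> h" "0 < n1" "h \<le> 4 * n1" "n1 \<le> n0"
    and rg: "(n0 - n1)\<^sup>2 \<le> 4 * h\<^sup>2 * int i" "4 * h\<^sup>2 * (int i + 1) \<le> (n0 + n1)\<^sup>2"
    and abc: "a * (4 * h\<^sup>2) = (2 * n0\<^sup>2 - (2 * int i + 1) * (4 * h\<^sup>2)) * 2 ^ d"
      "b * (4 * h\<^sup>2) = 4 * n0 * n1 * 2 ^ d" "c * (4 * h\<^sup>2) = 2 * n1\<^sup>2 * 2 ^ d"
    and ab: "\<alpha> * (2 * h) = (2 * n0 - 6 * h) * 2 ^ e" "\<beta> * (2 * h) = 2 * n1 * 2 ^ e"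
    and fits: "residual_fits 32 n0 n1 (- h) 0 (quad_comp a b c d P) (quad_comp \<alpha> \<beta> 0 e Q)"
  shows "lip_bdd (10 ^ 11) (5 * 10 ^ 13)
    (\<lambda>x. pval P (2 * x - 1) - pval Q (2 * sqrt (x + real i) - 3) / (2 * sqrt (x + real i)))"
proof -
  define s where "s = (\<lambda>x. sqrt (x + real i))"
  define V where "V = (\<lambda>x. (2 * h * s x - n0) / n1)"
  have h0: "real_of_int h \<ge> 16" "real_of_int n1 > 0" "real_of_int h \<le> 4 * real_of_int n1"
    "real_of_int n1 \<le> real_of_int n0"
    using h by linarith+
  have ss: "(s x)\<^sup>2 = x + real i" "1 \<le> s x" "s x \<le> 2" if "x \<in> {0..<1}" for x
  proof -
    show "(s x)\<^sup>2 = x + real i" using that by (simp add: s_def)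
    have "sqrt (real i) \<le> s x" "s x \<le> sqrt (real i + 1)" using that by (auto simp: s_def)
    then show "1 \<le> s x" "s x \<le> 2" using sqrt_digit_bounds[OF i] by linarith+
  qed
  have sl: "\<bar>s x - s y\<bar> \<le> \<bar>x - y\<bar> / 2" if "x \<in> {0..<1}" "y \<in> {0..<1}" for x y
  proof -
    have "(s x - s y) * (s x + s y) = x - y"
      using ss(1)[OF that(1)] ss(1)[OF that(2)] by (simp add: power2_eq_square algebra_simps)
    then have "\<bar>s x - s y\<bar> * (s x + s y) = \<bar>x - y\<bar>"
      using ss(2)[OF that(1)] ss(2)[OF that(2)] by (metis abs_mult abs_of_nonneg add_nonneg_nonneg order_trans zero_le_one)
    moreover have "\<bar>s x - s y\<bar> * 2 \<le> \<bar>s x - s y\<bar> * (s x + s y)"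
      using ss(2)[OF that(1)] ss(2)[OF that(2)] by (intro mult_left_mono) auto
    ultimately show ?thesis by simp
  qed
  have sV: "2 * h * s x = n0 + n1 * V x" for x using h0 by (simp add: V_def)
  have V: "lip_bdd 1 4 V"
    unfolding lip_bdd_def
  proof (intro conjI ballI lipschitz_onI)
    fix x :: real assume x: "x \<in> {0..<1}"
    have sq: "(2 * h * s x)\<^sup>2 = 4 * (real_of_int h)\<^sup>2 * (x + real i)"
      by (simp add: power_mult_distrib ss(1)[OF x])
    have "(real_of_int n0 - real_of_int n1)\<^sup>2 \<le> 4 * (real_of_int h)\<^sup>2 * real i"
      using rg(1)[THEN of_int_le_iff[where 'a=real, THEN iffD2]] by simp
    also have "\<dots> \<le> (2 * h * s x)\<^sup>2" unfolding sq using x by (intro mult_left_mono) auto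
    finally have 1: "real_of_int n0 - real_of_int n1 \<le> 2 * h * s x"
      by (rule power2_le_imp_le) (use h0 ss(2)[OF x] in simp)
    have "(2 * h * s x)\<^sup>2 \<le> 4 * (real_of_int h)\<^sup>2 * (real i + 1)" unfolding sq using x by (intro mult_left_mono) auto
    also have "\<dots> \<le> (real_of_int n0 + real_of_int n1)\<^sup>2"
      using rg(2)[THEN of_int_le_iff[where 'a=real, THEN iffD2]] by simp
    finally have 2: "2 * h * s x \<le> real_of_int n0 + real_of_int n1"
      by (rule power2_le_imp_le) (use h0 in linarith)
    have "-1 \<le> V x" "V x \<le> 1"
      unfolding V_def pos_le_divide_eq[OF h0(2)] pos_divide_le_eq[OF h0(2)] using 1 2 by linarith+
    then show "\<bar>V x\<bar> \<le> 1" by (simp add: abs_le_iff)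
  next
    fix x y :: real assume xy: "x \<in> {0..<1}" "y \<in> {0..<1}"
    have "V x - V y = (2 * h / n1) * (s x - s y)" by (simp add: V_def diff_divide_distrib[symmetric] right_diff_distrib)
    then have "\<bar>V x - V y\<bar> = (2 * h / n1) * \<bar>s x - s y\<bar>" using h0 by (simp add: abs_mult)
    \<comment> \<open>From h <= 4 * n1 follows 2 h / n1 <= 8, and s has slope at most 1/2.\<close>
    also have "\<dots> \<le> 8 * (\<bar>x - y\<bar> / 2)"
      using sl[OF xy] h0 by (intro mult_mono) (auto simp: field_simps)
    finally show "dist (V x) (V y) \<le> 4 * dist x y" by (simp add: dist_real_def)
  qed simp
  note z = lip_bdd_centered
  have zs: "lip_bdd 1 2 (\<lambda>x. 2 * s x - 3)"
    unfolding lip_bdd_def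
  proof (intro conjI ballI lipschitz_onI)
    fix x :: real assume x: "x \<in> {0..<1}"
    show "\<bar>2 * s x - 3\<bar> \<le> 1" using ss(2)[OF x] ss(3)[OF x] by (simp add: abs_le_iff)
  next
    fix x y :: real assume xy: "x \<in> {0..<1}" "y \<in> {0..<1}"
    have "2 * s x - 3 - (2 * s y - 3) = 2 * (s x - s y)" by simp
    then show "dist (2 * s x - 3) (2 * s y - 3) \<le> 2 * dist x y"
      unfolding dist_real_def using sl[OF xy] by (simp only: abs_mult)
  qed simp
  have hh: "real_of_int h \<noteq> 0" using h0 by simp
  have fr: "real_of_int u / 2 ^ k = v / w" if "real_of_int u * w = v * 2 ^ k" "w \<noteq> 0" for u v w and k :: nat
    using that by (simp add: frac_eq_eq)
  have abc': "real_of_int a / 2 ^ d = (2 * (real_of_int n0)\<^sup>2 - (2 * real i + 1) * (4 * (real_of_int h)\<^sup>2)) / (4 * (real_of_int h)\<^sup>2)"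
    "real_of_int b / 2 ^ d = 4 * n0 * n1 / (4 * (real_of_int h)\<^sup>2)"
    "real_of_int c / 2 ^ d = 2 * (real_of_int n1)\<^sup>2 / (4 * (real_of_int h)\<^sup>2)"
    "real_of_int \<alpha> / 2 ^ e = (2 * n0 - 6 * h) / (2 * real_of_int h)"
    "real_of_int \<beta> / 2 ^ e = 2 * n1 / (2 * real_of_int h)"
    by (rule fr, use arg_cong[OF abc(1), of real_of_int] in simp, use hh in simp)
       (rule fr, use arg_cong[OF abc(2), of real_of_int] in simp, use hh in simp,
        rule fr, use arg_cong[OF abc(3), of real_of_int] in simp, use hh in simp,
        rule fr, use arg_cong[OF ab(1), of real_of_int] in simp, use hh in simp,
        rule fr, use arg_cong[OF ab(2), of real_of_int] in simp, use hh in simp)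
  have zV: "2 * x - 1 = (of_int a + of_int b * V x + of_int c * (V x)\<^sup>2) / 2 ^ d" if x: "x \<in> {0..<1}" for x
  proof -
    have "(of_int a + of_int b * V x + of_int c * (V x)\<^sup>2) / 2 ^ d
        = of_int a / 2 ^ d + (of_int b / 2 ^ d) * V x + (of_int c / 2 ^ d) * (V x)\<^sup>2"
      by (simp add: add_divide_distrib)
    also have "\<dots> = (2 * (n0 + n1 * V x)\<^sup>2 - (2 * real i + 1) * (4 * (real_of_int h)\<^sup>2)) / (4 * (real_of_int h)\<^sup>2)"
      unfolding abc' using hh by (simp add: field_simps power2_eq_square)
    also have "\<dots> = 2 * (s x)\<^sup>2 - (2 * real i + 1)"
      unfolding sV[symmetric] using hh by (simp add: power_mult_distrib diff_divide_distrib)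
    finally show ?thesis using ss(1)[OF x] by simp
  qed
  have zsV: "2 * s x - 3 = (of_int \<alpha> + of_int \<beta> * V x + of_int 0 * (V x)\<^sup>2) / 2 ^ e" for x
  proof -
    have "(of_int \<alpha> + of_int \<beta> * V x + of_int 0 * (V x)\<^sup>2) / 2 ^ e = of_int \<alpha> / 2 ^ e + (of_int \<beta> / 2 ^ e) * V x"
      by (simp add: add_divide_distrib)
    also have "\<dots> = (2 * (n0 + n1 * V x) - 6 * h) / (2 * real_of_int h)"
      unfolding abc' using hh by (simp add: field_simps)
    also have "\<dots> = 2 * s x - 3" unfolding sV[symmetric] using hh by (simp add: diff_divide_distrib)
    finally show ?thesis ..
  qed
  let ?bP = "quad_comp a b c d P" and ?bQ = "quad_comp \<alpha> \<beta> 0 e Q"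
  obtain E1 where E1: "lip_bdd (real (length P) * (2 * real 150)) (real (length P) * (20 * (real 150)\<^sup>2)) E1"
    "\<And>x. x \<in> {0..<1} \<Longrightarrow> pval ?bP (V x) = pval P (2 * x - 1) + E1 x"
    using quad_comp_error[OF V z zV len(1)] by blast
  obtain E2 where E2: "lip_bdd (real (length Q) * (2 * real 150)) (real (length Q) * (20 * (real 150)\<^sup>2)) E2"
    "\<And>x. x \<in> {0..<1} \<Longrightarrow> pval ?bQ (V x) = pval Q (2 * s x - 3) + E2 x"
    using quad_comp_error[OF V zs zsV len(2)] by blast
  have E1': "lip_bdd 45000 67500000 E1" by (rule lip_bdd_mono[OF E1(1)]) (use len in auto)
  have E2': "lip_bdd 45000 67500000 E2" by (rule lip_bdd_mono[OF E2(1)]) (use len in auto)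
  \<comment> \<open>Multiplying P - Q / (2 s) by 2 h s = n0 + n1 V removes the square root from the
    denominator: what remains, (n0 + n1 V) P - h Q, is a polynomial in V, and its coefficients are
    what the check bounds.\<close>
  obtain rs where rs: "length rs \<le> Suc (max (length ?bP) (length ?bQ))" "\<forall>r\<in>set rs. \<bar>r\<bar> \<le> (2::real) ^ 32"
     "\<And>v. of_int n0 * pval ?bP v + of_int n1 * (of_int 0 + v * pval ?bP v) + of_int (- h) * pval ?bQ v
        = horner_sum (\<lambda>a. a) v rs"
    using residual_fits_imp[OF fits] by blast
  define R where "R = (\<lambda>x. horner_sum (\<lambda>a. a) (V x) rs)"
  have "length rs \<le> 301"
    using rs(1) length_quad_comp[of a b c d P] length_quad_comp[of \<alpha> \<beta> 0 e Q] len by linarith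
  then have l: "real (length rs) \<le> 301" by simp
  have R: "lip_bdd (2 ^ 32 * 301) (4 * 2 ^ 32 * 301\<^sup>2) R"
    unfolding R_def
    by (rule lip_bdd_mono[OF lip_bdd_horner[OF V rs(2)]])
       (use l power_mono[OF l, of 2] in \<open>auto intro!: mult_left_mono\<close>)
  have inv: "lip_bdd 1 (1/2) (\<lambda>x. 1 / s x)"
    unfolding lip_bdd_def
  proof (intro conjI ballI lipschitz_onI)
    fix x :: real assume x: "x \<in> {0..<1}"
    show "\<bar>1 / s x\<bar> \<le> 1" using ss(2)[OF x] by simp
  next
    fix x y :: real assume xy: "x \<in> {0..<1}" "y \<in> {0..<1}"
    have s1: "1 \<le> s x" "1 \<le> s y" using ss(2) xy by blast+
    then have "1 / s x - 1 / s y = (s y - s x) / (s x * s y)" by (simp add: field_simps)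
    then have "\<bar>1 / s x - 1 / s y\<bar> = \<bar>s x - s y\<bar> / (s x * s y)" using s1 by (simp add: abs_mult)
    also have "\<dots> \<le> (\<bar>x - y\<bar> / 2) / (1 * 1)" using sl[OF xy] s1 by (intro frac_le mult_mono) auto
    finally show "dist (1 / s x) (1 / s y) \<le> 1 / 2 * dist x y" by (simp add: dist_real_def)
  qed simp
  have ch: "lip_bdd (1 / 32) 0 (\<lambda>_. 1 / (2 * real_of_int h))"
    using h0 by (intro lip_bdd_const) (simp add: field_simps)
  have c2: "lip_bdd (1 / 2) 0 (\<lambda>_. 1 / 2)" by (rule lip_bdd_const) simp
  have "lip_bdd (1 / 32 * (2 ^ 32 * 301 * 1) + 45000 + 1 / 2 * (45000 * 1))
     (1 / 32 * (2 ^ 32 * 301 * (1 / 2) + 4 * 2 ^ 32 * 301\<^sup>2 * 1) + 0 * (2 ^ 32 * 301 * 1) + 67500000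
       + (1 / 2 * (45000 * (1 / 2) + 67500000 * 1) + 0 * (45000 * 1)))
     (\<lambda>x. 1 / (2 * real_of_int h) * (R x * (1 / s x)) - E1 x + 1 / 2 * (E2 x * (1 / s x)))"
    by (intro lip_bdd_add lip_bdd_diff lip_bdd_mult ch c2 R inv E1' E2')
  \<comment> \<open>The main terms are 2^27 * 301, about 4.04 * 10^10, for the size and 2^27 *
    (301/2 + 4 * 301^2), about 4.87 * 10^13, for the slope; 301 = 2 * 150 + 1 bounds the number of
    residual coefficients.\<close>
  then have "lip_bdd (10 ^ 11) (5 * 10 ^ 13)
     (\<lambda>x. 1 / (2 * real_of_int h) * (R x * (1 / s x)) - E1 x + 1 / 2 * (E2 x * (1 / s x)))"
    by (rule lip_bdd_mono) simp_all
  then show ?thesis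
  proof (rule lip_bdd_cong)
    fix x :: real assume x: "x \<in> {0..<1}"
    have s0: "s x \<noteq> 0" using ss(2)[OF x] by auto
    have "R x = (n0 + n1 * V x) * pval ?bP (V x) - h * pval ?bQ (V x)"
      unfolding R_def rs(3)[symmetric] by (simp add: algebra_simps)
    also have "\<dots> = 2 * h * s x * (pval P (2 * x - 1) + E1 x) - h * (pval Q (2 * s x - 3) + E2 x)"
      unfolding E1(2)[OF x] E2(2)[OF x] sV ..
    finally have Rx: "R x = \<dots>" .
    have sx: "sqrt (x + real i) = s x" by (simp add: s_def)
    show "1 / (2 * real_of_int h) * (R x * (1 / s x)) - E1 x + 1 / 2 * (E2 x * (1 / s x))
      = pval P (2 * x - 1) - pval Q (2 * sqrt (x + real i) - 3) / (2 * sqrt (x + real i))"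
      unfolding sx Rx using s0 hh by (simp add: field_simps)
  qed
qed

section \<open>Integrals of the integer polynomials\<close>

lemma integral_U_power:
  "(\<integral>x. (2 * x - 1) ^ m \<partial>unit_meas) = (if even m then 1 / real (Suc m) else 0)"
proof -
  define F where "F = (\<lambda>x::real. (2 * x - 1) ^ Suc m / (2 * real (Suc m)))"
  have "(\<integral>x. (2 * x - 1) ^ m \<partial>unit_meas) = (LBINT x. indicator {0..<1} x * (2 * x - 1) ^ m)"
    by (rule integral_U)
  also have "\<dots> = (LBINT x. (2 * x - 1) ^ m * indicator {0..1} x)"
    by (intro integral_cong_AE) (auto intro!: AE_I'[of "{1}"] simp: indicator_def split: if_splits)
  also have "\<dots> = F 1 - F 0"
  proof (rule integral_FTC_Icc_real)
    show "(F has_real_derivative (2 * x - 1) ^ m) (at x)" for x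
      unfolding F_def by (rule derivative_eq_intros refl | simp add: field_simps del: of_nat_Suc)+
    show "isCont (\<lambda>x. (2 * x - 1) ^ m) x" for x :: real by (intro continuous_intros)
  qed simp
  also have "\<dots> = (if even m then 1 / real (Suc m) else 0)"
    by (auto simp: F_def simp del: of_nat_Suc)
  finally show ?thesis .
qed

text \<open>Odd powers of \<open>2 * x - 1\<close> have integral 0, and the power \<open>k - 1\<close> has integral \<open>1 / k\<close> for odd \<open>k\<close>.\<close>

fun int_approx :: "int \<Rightarrow> int list \<Rightarrow> int" where
  "int_approx k [] = 0"
| "int_approx k [x] = x div k"
| "int_approx k (x # y # xs) = x div k + int_approx (k + 2) xs"

lemma div_error: "0 < k \<Longrightarrow> \<bar>of_int x / of_int k - real_of_int (x div k)\<bar> \<le> 1"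
  unfolding floor_divide_of_int_eq[where 'a=real, symmetric] by linarith

lemma integrable_U_poly: "integrable unit_meas (\<lambda>x. (2 * x - 1) ^ m * pval xs (2 * x - 1))"
proof -
  have "continuous_on {0..1} (\<lambda>x::real. pval xs (2 * x - 1))"
    by (induction xs) (auto intro!: continuous_intros)
  then have "continuous_on {0..1} (\<lambda>x::real. (2 * x - 1) ^ m * pval xs (2 * x - 1))"
    by (intro continuous_intros)
  then have "set_integrable lborel {0..1} (\<lambda>x::real. (2 * x - 1) ^ m * pval xs (2 * x - 1))"
    by (intro borel_integrable_compact[unfolded set_integrable_def[symmetric]]) auto
  then have "set_integrable lborel {0..<1} (\<lambda>x::real. (2 * x - 1) ^ m * pval xs (2 * x - 1))"
    by (rule set_integrable_subset) auto
  then show ?thesis by (subst integrable_restrict_space) (auto simp: set_integrable_def)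
qed

text \<open>The even power in front records the position in the list: two entries are consumed at a
  time, the odd one integrates to 0, and each integer division costs an error of at most 1.\<close>

lemma integral_U_poly:
  assumes "even m"
  shows "\<bar>(\<integral>x. (2 * x - 1) ^ m * pval xs (2 * x - 1) \<partial>unit_meas) - of_int (int_approx (int m + 1) xs)\<bar> \<le> length xs"
  using assms
proof (induction "int m + 1" xs arbitrary: m rule: int_approx.induct)
  case 1
  then show ?case by simp
next
  case (2 x)
  then show ?case using div_error[of "int m + 1" x] by (simp add: integral_U_power add.commute)
next
  case (3 x y xs)
  have p: "(2 * t - 1) ^ m * pval (x # y # xs) (2 * t - 1)
    = x * (2 * t - 1) ^ m + y * (2 * t - 1) ^ Suc m + (2 * t - 1) ^ (m + 2) * pval xs (2 * t - 1)" for t :: real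
    by (simp add: algebra_simps power2_eq_square power_add)
  have i: "integrable unit_meas (\<lambda>t. (2 * t - 1) ^ k)" for k
    using integrable_U_poly[of k "[1]"] by simp
  have "(\<integral>t. (2 * t - 1) ^ m * pval (x # y # xs) (2 * t - 1) \<partial>unit_meas)
    = x * (\<integral>t. (2 * t - 1) ^ m \<partial>unit_meas) + y * (\<integral>t. (2 * t - 1) ^ Suc m \<partial>unit_meas)
      + (\<integral>t. (2 * t - 1) ^ (m + 2) * pval xs (2 * t - 1) \<partial>unit_meas)"
    unfolding p using i[of m] i[of "Suc m"] integrable_U_poly[of "m + 2" xs] by simp
  also have "\<dots> = x / (int m + 1) + (\<integral>t. (2 * t - 1) ^ (m + 2) * pval xs (2 * t - 1) \<partial>unit_meas)"
    unfolding integral_U_power using 3(2) by (simp add: add.commute)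
  finally show ?case
    using div_error[of "int m + 1" x] 3(1)[of "m + 2"] 3(2) by (simp add: algebra_simps)
qed


section \<open>Evaluation of integer arithmetic on bit strings\<close>

text \<open>Integers are evaluated as two's complement bit strings, least significant bit outermost,
  terminated by \<open>bzero\<close> or \<open>bneg\<close>; \<open>div 2 ^ d\<close> then just drops bits.\<close>

definition bzero :: int where "bzero = 0"
definition bneg :: int where "bneg = -1"
definition bit0 :: "int \<Rightarrow> int" where "bit0 x = 2 * x"
definition bit1 :: "int \<Rightarrow> int" where "bit1 x = 2 * x + 1"
definition add1 :: "int \<Rightarrow> int \<Rightarrow> int" where "add1 x y = x + y + 1"
definition bnot :: "int \<Rightarrow> int" where "bnot x = - x - 1"
definition bnum :: "num \<Rightarrow> int" where "bnum n = numeral n"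
definition is_sign :: "int \<Rightarrow> bool" where "is_sign x \<longleftrightarrow> x \<in> {0, -1}"
definition is_zero :: "int \<Rightarrow> bool" where "is_zero x \<longleftrightarrow> x = 0"
definition is_neg1 :: "int \<Rightarrow> bool" where "is_neg1 x \<longleftrightarrow> x = -1"

lemmas bit_defs = bzero_def bneg_def bit0_def bit1_def add1_def bnot_def bnum_def is_sign_def is_zero_def is_neg1_def

lemma bit_numeral:
  "0 = bzero" "1 = bit1 bzero" "numeral n = bnum n" "- 1 = bneg" "- numeral n = - bnum n"
  "bnum num.One = bit1 bzero" "bnum (num.Bit0 n) = bit0 (bnum n)" "bnum (num.Bit1 n) = bit1 (bnum n)"
  unfolding bit_defs by (simp_all add: numeral_Bit0 [of n] numeral_Bit1 [of n])

text \<open>\<open>add1\<close> is addition with a carry. Products recurse on the left factor, which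
  in \<open>quad_step\<close> and \<open>residual_fits\<close> is a small fixed parameter, so each
  costs only a few additions of long strings. The first two rules absorb redundant sign
  bits.\<close>

lemma bit_arith:
  "bit0 bzero = bzero" "bit1 bneg = bneg"
  "bit0 x + bit0 y = bit0 (x + y)" "bit1 x + bit0 y = bit1 (x + y)"
  "bit0 x + bit1 y = bit1 (x + y)" "bit1 x + bit1 y = bit0 (add1 x y)"
  "add1 (bit0 x) (bit0 y) = bit1 (x + y)" "add1 (bit1 x) (bit0 y) = bit0 (add1 x y)"
  "add1 (bit0 x) (bit1 y) = bit0 (add1 x y)" "add1 (bit1 x) (bit1 y) = bit1 (add1 x y)"
  "bzero + y = y" "x + bzero = x" "bneg + bneg = bit0 bneg"
  "bneg + bit0 x = bit1 (bneg + x)" "bneg + bit1 x = bit0 x"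
  "bit0 x + bneg = bit1 (x + bneg)" "bit1 x + bneg = bit0 x"
  "add1 bneg y = y" "add1 x bneg = x" "add1 bzero bzero = bit1 bzero"
  "add1 bzero (bit0 x) = bit1 x" "add1 bzero (bit1 x) = bit0 (add1 bzero x)"
  "add1 (bit0 x) bzero = bit1 x" "add1 (bit1 x) bzero = bit0 (add1 x bzero)"
  "bnot bzero = bneg" "bnot bneg = bzero" "bnot (bit0 x) = bit1 (bnot x)" "bnot (bit1 x) = bit0 (bnot x)"
  "- bzero = bzero" "- bneg = bit1 bzero" "- bit0 x = bit0 (- x)" "- bit1 x = bit1 (bnot x)"
  "bzero * x = bzero" "bneg * x = - x" "bit0 x * y = bit0 (x * y)" "bit1 x * y = y + bit0 (x * y)"
  by (simp_all add: bit_defs algebra_simps)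

lemma bit_shr:
  "shr 0 x = x" "shr (Suc d) (bit0 x) = shr d x" "shr (Suc d) (bit1 x) = shr d x"
  "shr d bzero = bzero" "shr d bneg = bneg" "fits d x = is_sign (shr d x)"
  by (simp_all add: shr_def fits_def bit_defs zdiv_zmult2_eq div_eq_minus1)

lemma bit_scons:
  "scons x [] = (if is_sign x then [] else [x])" "scons x (y # ys) = x # y # ys"
  "is_sign bzero = True" "is_sign bneg = True" "is_sign (bit0 x) = is_zero x" "is_sign (bit1 x) = is_neg1 x"
  "is_zero bzero = True" "is_zero bneg = False" "is_zero (bit0 x) = is_zero x" "is_zero (bit1 x) = False"
  "is_neg1 bzero = False" "is_neg1 bneg = True" "is_neg1 (bit1 x) = is_neg1 x" "is_neg1 (bit0 x) = False"
  by (auto simp: scons_def bit_defs) presburger+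

lemmas bit_eval = bit_numeral bit_arith bit_shr bit_scons quad_step.simps add_const.simps quad_comp.simps
  padd.simps residual_fits.simps numeral_eq_Suc pred_numeral_simps BitM.simps if_True if_False simp_thms

text \<open>The \<open>k\<close>-th entry of \<open>coeffs\<^sub>i\<close> is \<open>2 ^ 222\<close> times the \<open>k\<close>-th coefficient, in powers of \<open>2 * x - 1\<close>,
  of the \<open>i\<close>-th summand of \<open>L h\<close> for a numerical approximation \<open>h\<close> of the invariant density
  (Chebyshev collocation), rounded. Only the checks below rely on these numbers.\<close>

definition coeffs1 :: "int list" where
  "coeffs1 = [
    3044716419247255245427251248289156371445158265789998079907719778731,
    -798432386599811116272143272016773329438335185859400795655195847664,
    234895050848591259874905804201150561445982225507630146808313600814,
    -72068644913846453856913469214713087716109997962546025279557919359,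
    22591500036675596581508392640697622140086071124932053220428231389,
    -7174078086316364794364064502787409380449492846298320530042694410,
    2297886036257847876446511076459568387916270145490800371709094560,
    -740543927496524456266556332864697630611655613437823988402823405,
    239748698593388598717073728921992654549642267484500433075432443,
    -77892210574868853158960006328619742506715721205643290432754370,
    25377533074545694834262848055917731819871799600249034799749109,
    -8286941137746970121993640489219825460063484533777262183576650,
    2711178794157963684123114696206139185548173505612535774246234,
    -888404139195407350967480087580154015221555725969316011454740,
    291507261229754267048735111623414706021821605196944820575667,
    -95762007167981542853238135334802959899013332294973142216488,
    31490269653044234396333938634016603659983633897278799947881,
    -10364416670056667729470401885199685079099534989108278115665,
    3413924813484160770260640991118153121822298843325804076954,
    -1125294334033553240412013617078816197180203991534215886913,
    371150164611917819504145651136980151445458550031894016091,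
    -122483456273650279621771793977954141388807021665086754606,
    40441397592336961176498460934020559814901582326523639792,
    -13359052169693312786879627733393289694229283166587229350, 4414772378210565876437477873190167296104715116072554006,
    -1459515638333665862113832277642396416056817357357424051, 482684518762262450689389598614164896385962479989766834,
    -159683535157966657379643320662871506437377784748918002, 52843108660685177480254155895179036551279735201096057,
    -17491959767807914674979822454771428708647538896488048, 5791644546634419077623421777778510328260256648914588,
    -1918098616668259317504187858431950686554112738934687, 635387398386627909349822695805791640052432909478256,
    -210522529895890604603989804058185554155376241296331, 69766211901610114214137112191730771413968270083642,
    -23124537420786546669849847223093382519424806684035, 7666153918630002738632507238041794295253252322552,
    -2541875096848524229246728033327382031812349395165, 842944629809123768378287780042577990696945464650,
    -279581454482503641430985908212687717494754356842, 92742484959574977385362480168690673265539064213,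
    -30768547790971956417612701585215655623344400629, 10209165661443984659054091784828979236314009074,
    -3387862493166821818710023827619880574202918700, 1124374667192667703521981785949820346636551257,
    -373201807845196423028103240942879033849513799, 123885834175463034899725863772618386177764727,
    -41128487924321640411874631341714603471905117, 13655421540954449756732437893172476552602583,
    -4534265714250990073273060965231011063658744, 1505728371710016324218363034475899032612833,
    -500060485687017890683721106956187552119632, 166086067227116126640226709338368413838074,
    -55166728573462861052194779006092430083801, 18325393713740845070980044631129417951875,
    -6087797721366674515063987190118811883156, 2022538330664635529201656558649571124556,
    -671988515625980181632198816962498031240, 223282372500125220182223280878330932557,
    -74194810894471303062145166864986930569, 24655748680069635627059976154048823927,
    -8193841037757726819962354611609539037, 2723207318031874935372939311135344359,
    -905100706815346172696743927597278681, 300839851147329923987747366701437497, -99998931731813545245871795613543919,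
    33241161979005529656812169164559226, -11050379975882436222409256528047557, 3673649981830101878578395394239818,
    -1221341978000709991028886259725376, 406064630964294904486433512330871, -135011530933623867001010831143259,
    44891472774081986586235889812707, -14927037876197102344921054156845, 4963633676688380839536643062834,
    -1650599290408744032920387776573, 548907274120835575349596442710, -182545567873295772753871882302,
    60709711080723611704784657655, -20191064358045072819515886362, 6715433563567938820309183623,
    -2233584232390593444755039826, 742922820611539370400365363, -247114262956336224852182457,
    82198587282877973051351188, -27342801526486417682565634, 9095644596794003202809183, -3025766995833561495130764,
    1006580999472269343137161, -334867464534306605503027, 111405824851176530163410, -37064087406659530210268,
    12331302460123549850710, -4102745528345535865344, 1365054455665076376223, -454187230172922234533,
    151122523490260639749, -50284322632178968544, 16731887772831356308, -5567574293439136212, 1852659689364824053,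
    -616500816490866992, 205153938114564767, -68270657967200633, 22719364687905145, -7560769212254855,
    2516189410172354, -837390593454638, 278689161795370, -92751126345506, 30869193217934, -10273967937054,
    3419462481072, -1138109538825, 378805908261, -126082776993, 41966331946, -13968583502, 4649537189, -1547650799,
    515159859, -171481290, 57081720, -19001280, 6325197, -2105574, 700926, -233335, 77677, -25859, 8609, -2866, 954,
    -318, 106, -35, 12, -4, 1]"

definition coeffs2 :: "int list" where
  "coeffs2 = [
    2032271061110728677985519865887694910647449468141585157293245945022,
    -323683214864762261983416305794229659768389023205670954997540899346,
    57305022923841297713077895321076156172704775066271860529159857117,
    -10554643616974185537739500292799841128044021381938180674043382537,
    1984459518194078056974636930000023964798894988577855388336106287,
    -377841661934297741366088371900368799975131164581736074135986499,
    72553064908812219176204765959503052032723115954103621522444283,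
    -14016489555277412770321305774600598478622822537879283447997064,
    2720213608442111096642382723082274593745786731084636171943972,
    -529792652420474453609525835106303587269126195519330076733130,
    103475617694562377884860797441656615262327826751289771353561,
    -20256916407096322464438939912599914094184267609295929058302,
    3973216270933689677088220369738353828956856486281009115267,
    -780574056553540299138842542531873005850402568296803987826,
    153562987848206370453597564225778520765429090052353316423,
    -30246672381527709748245916350111172805331943061604758142, 5963768588947275753713973260003238977327902604856381452,
    -1176959285937073885182390839486929088756223316272111691, 232463144102799683046206456342868010658130053447183332,
    -45947361426568814431842688312966611850417050662161132, 9087583991641845174077316905946800676420674784525483,
    -1798415233914041244623157689621690043430298264013703, 356091246006701133577619480468344311107785629922816,
    -70541012902424136963907731719330586333748357123852, 13980189811336866275307043373353409105872954505319,
    -2771785051419636807955497649583732267841052551083, 549752382011982412497591616092040457877089773069,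
    -109074531719433335431940345385945020624577239174, 21647970778970839154848383631372866042507555797,
    -4297726052494121906212563995995252074722598437, 853451956067141691942742772188690302950408579,
    -169523625742209121920071439442294777643314611, 33680998047946370973045477242383316115994604,
    -6693244216703102327774895988358026302114902, 1330391365186991028611902577997333589273931,
    -264489077816428511097841300274076279092056, 52591633919946930817248874975770292650926,
    -10459275762257030918643769361624791660101, 2080455322411004804989650308462598178527,
    -413888289241405956265308525634449699942, 82351645047393967094304549152423088080,
    -16387870201404542182031273057622868577, 3261600689484147456863396360663527906,
    -649223549884366855665521734820442062, 129243973220752772948663762006024784, -25732171613266784278451601493390663,
    5123778978250949283970804768898514, -1020351961407644139870162305051904, 203213840335369768676625960370777,
    -40476070946287229269725374713319, 8062754527034146057091810355473, -1606226905527046833134460231984,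
    320012666116606753822086973256, -63762125737657373112703322558, 12705517918925196054944411166,
    -2531947063272870593746403579, 504601225711232076610298470, -100570879387487578081302846,
    20045890725220352256632652, -3995826195984251055678316, 796553500694923146693198, -158799635482391753555485,
    31659886126229368011535, -6312387387288581206029, 1258640140481207284516, -250976109812124590914,
    50047838539892607195, -9980670240615303771, 1990466435882062265, -396981386731694583, 79178077977086198,
    -15792784475534056, 3150147197008500, -628377807592657, 125351106212968, -25006467981581, 4988763540677,
    -995289483803, 198573554117, -39619453861, 7905152324, -1577343567, 314743148, -62805813, 12533046, -2501073,
    499124, -99610, 19880, -3968, 792, -158, 32, -6, 1]"

definition coeffs3 :: "int list" where
  "coeffs3 = [
    1552698557390259682178027674995076561708588200956838781084007485403,
    -178257733548185499351395330591059043052223941901394613485019658365,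
    22608605216346598955170026024483417592265067299188516518134775647,
    -2977666629292464592641286016581912045175273012579214894441738127,
    400034846050109974001357556887052862582283121921905650889745829,
    -54404088595819947524120828467910213236963093963958437953722674,
    7460397149343755727252181705661765754227938509707206239787366,
    -1029166586776578324344301555040554993933313580972971057048770,
    142615107394550907445182076214345023803616502241238492889463,
    -19832245528462194582910240345030537364732217517727398196417,
    2765677568432443848019793290407626048807606222636321836491,
    -386574029657920155950106852062079777968222567597465107906,
    54137497156593879252724972017350424516035336971957003440, -7593973960426123131788957454270448834364181697815343624,
    1066704007098165311076408145828883358126126563075049022, -150017281531982229048949989811579728705818907959013404,
    21120054714798465149542090278309519186855162237953589, -2976121520263317618541303166537911996823211224360354,
    419722959730283781502337635016439573226934593273125, -59236991126770989762185208960630823963364360504358,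
    8365828510482733405195194309111401906970721405118, -1182177782353785616291564393759146828164001468306,
    167143879493157739060835120084948773783735720497, -23643466333154812922408617641495115906748155189,
    3346004851728805644126831027758863342771413558, -473718890970854452268193594680636846730036113,
    67093338049032165008302933905124358551748478, -9505830868469675147291903861249788759099848,
    1347229382524906276902007020922039258178727, -190995772830051094472323481845388514424050,
    27084928559604733904394564461715595843821, -3841892701442644091649527049741696237125,
    545090996916368943725165979907095138436, -77355705057620917741799603508102839688,
    10980172726931302538346306745926672227, -1558884465727960652835354445642841655,
    221361221499385855106491097531156365, -31438900771307681219188012522011885, 4465880278535313554958571247048232,
    -634478287438675468776616246234932, 90155613294471888589143871005937, -12812436471745708880129642450790,
    1821086169527020657146836157029, -258872656700310961934988394952, 36804089393577430196258229157,
    -5233083528139904303368147897, 744163904221901562828713050, -105834358625510435120184669,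
    15053235494025150451080126, -2141293480176913789245687, 304623841451787534233462, -43340233228545304107038,
    6166754462491776536707, -877523231329088550018, 124880814288770800091, -17773240347505919929, 2529705890174024906,
    -360084790617589101, 51258951337992920, -7297326437155811, 1038929144903363, -147922832594502, 21062538353523,
    -2999242198497, 427107175928, -60825530679, 8662792207, -1233820888, 175738891, -25032518, 3565837, -507970, 72366,
    -10310, 1469, -209, 30, -4, 1]"

definition coeffs_sum :: "int list" where
  "coeffs_sum = padd coeffs1 (padd coeffs2 coeffs3)"

section \<open>Verification of the approximate density\<close>

lemma length_padd: "length (padd xs ys) = max (length xs) (length ys)"
  by (induction xs ys rule: padd.induct) auto

lemma length_coeffs: "length coeffs1 \<le> 150" "length coeffs2 \<le> 150" "length coeffs3 \<le> 150" "length coeffs_sum \<le> 150"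
  unfolding coeffs_sum_def length_padd by (simp_all add: coeffs1_def coeffs2_def coeffs3_def)

text \<open>Here s = (39 + 7 * V) / 32 ranges over [1, 23/16], which contains [1, sqrt 2]. A power
  of two as denominator makes the substitution exact in dyadic numbers. Coefficients of size about
  2^222 have to cancel down to 2^32.\<close>

lemma residual_fits_1:
  "residual_fits 32 39 7 (- 16) 0 (quad_comp (- 15) 546 49 9 coeffs1)
    (quad_comp (- 9) 7 0 4 coeffs_sum)"
  by (simp only: bit_eval coeffs_sum_def coeffs1_def coeffs2_def coeffs3_def)

text \<open>Here s = (202 + 21 * V) / 128 ranges over [181/128, 223/128], which contains
  [sqrt 2, sqrt 3].\<close>

lemma residual_fits_2:
  "residual_fits 32 202 21 (- 64) 0 (quad_comp (- 156) 8484 441 13 coeffs2)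
    (quad_comp 10 21 0 6 coeffs_sum)"
  by (simp only: bit_eval coeffs_sum_def coeffs1_def coeffs2_def coeffs3_def)

text \<open>Here s = (60 + 5 * V) / 32 ranges over [55/32, 65/32], which contains
  [sqrt 3, 2].\<close>

lemma residual_fits_3:
  "residual_fits 32 60 5 (- 16) 0 (quad_comp 16 600 25 9 coeffs3)
    (quad_comp 12 5 0 4 coeffs_sum)"
  by (simp only: bit_eval coeffs_sum_def coeffs1_def coeffs2_def coeffs3_def)

lemma residual_lip_bdd_1:
  "lip_bdd (10 ^ 11) (5 * 10 ^ 13) (\<lambda>x. pval coeffs1 (2 * x - 1) - btransfer 1 (\<lambda>x. pval coeffs_sum (2 * x - 1)) x)"
proof -
  have "lip_bdd (10 ^ 11) (5 * 10 ^ 13) (\<lambda>x. pval coeffs1 (2 * x - 1)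
      - pval coeffs_sum (2 * sqrt (x + real 1) - 3) / (2 * sqrt (x + real 1)))"
    by (rule residual_lip_bdd[OF _ _ _ _ _ _ _ _ _ _ _ _ _ _ residual_fits_1])
       (simp_all add: length_coeffs)
  then show ?thesis by (simp add: btransfer_def branch_def algebra_simps)
qed

lemma residual_lip_bdd_2:
  "lip_bdd (10 ^ 11) (5 * 10 ^ 13) (\<lambda>x. pval coeffs2 (2 * x - 1) - btransfer 2 (\<lambda>x. pval coeffs_sum (2 * x - 1)) x)"
proof -
  have "lip_bdd (10 ^ 11) (5 * 10 ^ 13) (\<lambda>x. pval coeffs2 (2 * x - 1)
      - pval coeffs_sum (2 * sqrt (x + real 2) - 3) / (2 * sqrt (x + real 2)))"
    by (rule residual_lip_bdd[OF _ _ _ _ _ _ _ _ _ _ _ _ _ _ residual_fits_2])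
       (simp_all add: length_coeffs)
  then show ?thesis by (simp add: btransfer_def branch_def algebra_simps)
qed

lemma residual_lip_bdd_3:
  "lip_bdd (10 ^ 11) (5 * 10 ^ 13) (\<lambda>x. pval coeffs3 (2 * x - 1) - btransfer 3 (\<lambda>x. pval coeffs_sum (2 * x - 1)) x)"
proof -
  have "lip_bdd (10 ^ 11) (5 * 10 ^ 13) (\<lambda>x. pval coeffs3 (2 * x - 1)
      - pval coeffs_sum (2 * sqrt (x + real 3) - 3) / (2 * sqrt (x + real 3)))"
    by (rule residual_lip_bdd[OF _ _ _ _ _ _ _ _ _ _ _ _ _ _ residual_fits_3])
       (simp_all add: length_coeffs)
  then show ?thesis by (simp add: btransfer_def branch_def algebra_simps)
qed

lemma int_approx_1: "int_approx 1 coeffs1 =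
  3127890514801664760370154242502973082936691450055346171351247121714"
  by (simp add: coeffs1_def)

lemma int_approx_2: "int_approx 1 coeffs2 =
  2051780304014936871005662433479123962451964152939969806533553131258"
  by (simp add: coeffs2_def)

lemma int_approx_3: "int_approx 1 coeffs3 =
  1560315847971058317290937095772810623020630502639827142391102309258"
  by (simp add: coeffs3_def)


section \<open>Conclusion: numerical frequencies and transfer to the invariant measure\<close>

lemma pval_lipschitz_ex: "\<exists>C. C-lipschitz_on {0..<1} (\<lambda>x. pval xs (2 * x - 1))"
proof -
  define m where "m = (\<Sum>r\<leftarrow>xs. \<bar>real_of_int r\<bar>)"
  have "\<bar>real_of_int r\<bar> \<le> m" if "r \<in> set xs" for r
    unfolding m_def using that by (intro member_le_sum_list) auto
  moreover have "0 \<le> m" unfolding m_def by (intro sum_list_nonneg) auto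
  ultimately have "lip_bdd (m * real (length (map real_of_int xs))) (2 * m * (real (length (map real_of_int xs)))\<^sup>2)
      (\<lambda>x. horner_sum (\<lambda>a. a) (2 * x - 1) (map real_of_int xs))"
    by (intro lip_bdd_horner[OF lip_bdd_centered]) auto
  moreover have "horner_sum (\<lambda>a. a) v (map real_of_int xs) = pval xs v" for v
    by (induction xs) auto
  ultimately show ?thesis by (auto simp: lip_bdd_def)
qed

text \<open>Error budget: 10^15 for p not being an exact fixed point, 10^11 for replacing the i-th
  summand of \<open>transfer p\<close> by its polynomial, and 150 + 450 for rounded
  integrals.\<close>

lemma freq_coeffs:
  assumes i: "i \<in> {1,2,3}" and c: "c 1 = coeffs1" "c 2 = coeffs2" "c 3 = coeffs3"
  shows "\<bar>of_int (int_approx 1 (c i)) - of_int (\<Sum>j\<in>{1,2,3}. int_approx 1 (c j)) * freq i\<bar> \<le> 2 * 10 ^ 15"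
proof -
  note c = c c(1)[unfolded One_nat_def]
  define p where "p = (\<lambda>x. pval coeffs_sum (2 * x - 1))"
  define q where "q = (\<lambda>j x. pval (c j) (2 * x - 1))"
  obtain C where C: "C-lipschitz_on {0..<1} p" using pval_lipschitz_ex unfolding p_def by blast
  have res: "lip_bdd (10 ^ 11) (5 * 10 ^ 13) (\<lambda>x. q j x - btransfer j p x)" if "j \<in> {1,2,3}" for j
    using that residual_lip_bdd_1 residual_lip_bdd_2 residual_lip_bdd_3 unfolding p_def q_def by (auto simp: c)
  have p: "p x = q 1 x + q 2 x + q 3 x" for x
    by (simp add: p_def q_def c coeffs_sum_def pval_padd)
  have qint: "integrable unit_meas (q j)" for j
    using integrable_U_poly[of 0 "c j"] by (simp add: q_def)
  have len: "length (c j) \<le> 150" if "j \<in> {1,2,3}" for j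
    using that by (auto simp: c length_coeffs)
  have q_int: "\<bar>(\<integral>x. q j x \<partial>unit_meas) - of_int (int_approx 1 (c j))\<bar> \<le> 150" if "j \<in> {1,2,3}" for j
    using integral_U_poly[of 0 "c j"] len[OF that] by (simp add: q_def)
  have "(\<lambda>x. (q 1 x - btransfer 1 p x) + (q 2 x - btransfer 2 p x) + (q 3 x - btransfer 3 p x))
      = (\<lambda>x. p x - transfer p x)"
    by (simp add: p transfer_unfold fun_eq_iff)
  moreover have "lip_bdd (10 ^ 11 + 10 ^ 11 + 10 ^ 11) (5 * 10 ^ 13 + 5 * 10 ^ 13 + 5 * 10 ^ 13)
      (\<lambda>x. (q 1 x - btransfer 1 p x) + (q 2 x - btransfer 2 p x) + (q 3 x - btransfer 3 p x))"
    by (intro lip_bdd_add res) auto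
  ultimately have "lip_bdd (10 ^ 11 + 10 ^ 11 + 10 ^ 11) (5 * 10 ^ 13 + 5 * 10 ^ 13 + 5 * 10 ^ 13)
      (\<lambda>x. p x - transfer p x)" by (simp only:)
  then have "(15 * 10 ^ 13)-lipschitz_on {0..<1} (\<lambda>x. p x - transfer p x)"
    by (simp add: lip_bdd_def)
  \<comment> \<open>The three residual slopes give D = 15 * 10^13, and D * 20 / 3 = 10^15.\<close>
  from digit_freq_approx[OF C this, of i]
  have 1: "\<bar>(\<integral>x. digit_ind i x * p x \<partial>unit_meas) - (\<integral>x. p x \<partial>unit_meas) * freq i\<bar> \<le> 10 ^ 15" by simp
  \<comment> \<open>This replaces the integral of p up to irrational ends by one over [0,1), which
    the polynomial q i approximates.\<close>
  have 2: "(\<integral>x. digit_ind i x * p x \<partial>unit_meas) = (\<integral>x. btransfer i p x \<partial>unit_meas)"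
    using integral_digit_transfer[OF i C, of "\<lambda>_. 1" 1] by simp
  have bint: "integrable unit_meas (btransfer i p)"
    by (rule lipschitz_integrable_U[OF btransfer_lipschitz[OF i C lipschitz_unit_bounded[OF C]]])
  have "\<bar>\<integral>x. q i x - btransfer i p x \<partial>unit_meas\<bar> \<le> 10 ^ 11"
    using res[OF i] qint[of i] bint by (intro integral_U_le) (auto simp: lip_bdd_def)
  then have 3: "\<bar>(\<integral>x. q i x \<partial>unit_meas) - (\<integral>x. btransfer i p x \<partial>unit_meas)\<bar> \<le> 10 ^ 11"
    using qint[of i] bint by simp
  have "(\<integral>x. p x \<partial>unit_meas) = (\<integral>x. q 1 x \<partial>unit_meas) + (\<integral>x. q 2 x \<partial>unit_meas) + (\<integral>x. q 3 x \<partial>unit_meas)"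
    unfolding p using qint by simp
  then have 4: "\<bar>(\<integral>x. p x \<partial>unit_meas) - of_int (\<Sum>j\<in>{1,2,3}. int_approx 1 (c j))\<bar> \<le> 450"
    using q_int[of 1] q_int[of 2] q_int[of 3] by simp
  have "\<bar>((\<integral>x. p x \<partial>unit_meas) - of_int (\<Sum>j\<in>{1,2,3}. int_approx 1 (c j))) * freq i\<bar> \<le> 450 * 1"
    unfolding abs_mult using 4 freq_bounds[of i] by (intro mult_mono) auto
  then have "\<bar>(\<integral>x. p x \<partial>unit_meas) * freq i - of_int (\<Sum>j\<in>{1,2,3}. int_approx 1 (c j)) * freq i\<bar> \<le> 450"
    by (simp add: left_diff_distrib)
  moreover have "\<bar>w - y\<bar> \<le> 2 * 10 ^ 15"
    if "\<bar>x - y\<bar> \<le> 450" "\<bar>v - x\<bar> \<le> 10 ^ 15" "\<bar>u - v\<bar> \<le> 10 ^ 11" "\<bar>u - w\<bar> \<le> 150" for u v w x y :: real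
    using that by simp
  ultimately show ?thesis using 1[unfolded 2] 3 q_int[OF i] by blast
qed

text \<open>The decimals in \<open>BR_F\<close> are truncated, not rounded: \<open>f\<^sub>1 - F\<^sub>1\<close> is about \<open>0.913 / 10 ^ 50\<close>, which is
  why the coefficients carry 222 bits.\<close>

lemma freq_bound:
  assumes "i \<in> {1,2,3}"
  shows "\<bar>freq i - BR_F i\<bar> < 1 / 10 ^ 50"
proof -
  define c where "c = (\<lambda>i::nat. if i = 1 then coeffs1 else if i = 2 then coeffs2 else coeffs3)"
  have "\<bar>of_int (int_approx 1 (c i)) - of_int (\<Sum>j\<in>{1,2,3}. int_approx 1 (c j)) * freq i\<bar> \<le> 2 * 10 ^ 15"
    by (rule freq_coeffs[OF assms]) (simp_all add: c_def)
  then show ?thesis using assms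
    by (auto simp: c_def int_approx_1 int_approx_2 int_approx_3 BR_F_def abs_le_iff abs_less_iff)
qed

theorem mainTheorem3:
  fixes M :: "real measure"
  assumes "BR_acim M"
  shows "\<exists>f :: nat \<Rightarrow> real.
           (\<forall>i\<in>{1,2,3}. \<bar>f i - BR_F i\<bar> < 1 / 10 ^ 50) \<and>
           (AE x in M. \<forall>i\<in>{1,2,3}.
              (\<lambda>n. real (card {k \<in> {1..n}. BR_digit k x = i}) / real n) \<longlonglongrightarrow> f i)"
proof (intro exI[of _ freq] conjI)
  show "\<forall>i\<in>{1,2,3}. \<bar>freq i - BR_F i\<bar> < 1 / 10 ^ 50" using freq_bound by blast
  have "AE x in unit_meas. \<forall>i\<in>{1,2,3}. (\<lambda>n. real (card {k \<in> {1..n}. BR_digit k x = i}) / real n) \<longlonglongrightarrow> freq i"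
    using AE_digit_frequency by (subst AE_ball_countable) auto
  \<comment> \<open>Lebesgue null sets are null for M, so the frequencies obtained under Lebesgue
    measure hold almost everywhere for M as well.\<close>
  then show "AE x in M. \<forall>i\<in>{1,2,3}. (\<lambda>n. real (card {k \<in> {1..n}. BR_digit k x = i}) / real n) \<longlonglongrightarrow> freq i"
    using assms by (intro absolutely_continuous_AE[of M unit_meas]) (auto simp: BR_acim_def)
qed

end
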